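(* Let $\sigma>0$ and let $(Y_1,X_1),\dots,(Y_n,X_n)$ be an i.i.d. sample of $(Y,X)$ obeying $Y=\int_0^1\beta(t)X(t)\,dt+\sigma\epsilon$. Let $\gamma=(\gamma_j)_{j\ge1}$ and $\omega=(\omega_j)_{j\ge1}$ be strictly positive sequences with $\gamma_1=\omega_1=1$ such that $\gamma$ and $(\gamma_j/\omega_j)_{j\ge1}$ are nondecreasing. Let $\beta\in\mathcal F_\gamma$, $X\in\mathcal X^4_\eta$ and $\epsilon\in\mathcal E^4_\eta$ for some $\eta\ge1$. Consider the estimator $$\widehat\beta=\sum_{j=1}^m\frac{\widehat g_j}{\widehat\lambda_j}\,\mathbf 1\{\widehat\lambda_j\ge\alpha\}\,\psi_j$$ with dimension $m=m(n)\in\mathbb N$ and threshold $\alpha=\alpha(n)>0$ satisfying $m\to\infty$, $\alpha=o(1)$ and $(\sup_{j\le m}\omega_j)\,(n\alpha^2)^{-1}=o(1)$ as $n\to\infty$. Then $\mathbb E\|\widehat\beta-\beta\|_\omega^2=o(1)$ as $n\to\infty$.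
   Context: $L^2[0,1]$ has its usual inner product $\langle\cdot,\cdot\rangle$ and norm $\|\cdot\|$. Model: $Y=\int_0^1\beta(t)X(t)dt+\sigma\epsilon$, where $\beta\in L^2[0,1]$, $X$ is a random function with values in $L^2[0,1]$, centered, with $\mathbb E\|X\|^2<\infty$, and $\epsilon$ is a real error term with mean zero and variance one, uncorrelated with $X$ (i.e. $\mathbb E[\epsilon\langle X,f\rangle]=0$ for all $f\in L^2[0,1]$). Trigonometric basis of $L^2[0,1]$: $\psi_1\equiv1$, $\psi_{2j}(s)=\sqrt2\cos(2\pi js)$, $\psi_{2j+1}(s)=\sqrt2\sin(2\pi js)$, $j\in\mathbb N=\{1,2,\dots\}$. $X$ is second order stationary: $\mathrm{Cov}(X(t),X(s))=c(t-s)$ for $s,t\in[0,1]$, with $c:[-1,1]\to\mathbb R$ positive definite. Its covariance operator is $(Tf)(s)=\int_0^1\mathrm{Cov}(X(t),X(s))f(t)dt$. Standing property: $T$ is strictly positive and diagonal in the trigonometric basis, $T\psi_j=\lambda_j\psi_j$ with $\lambda_j=\mathbb E\langle X,\psi_j\rangle^2>0$ for all $j\ge1$ (so $\langle X,\psi_j\rangle/\sqrt{\lambda_j}$, $j\ge1$, are centered, of variance one and pairwise uncorrelated). For a strictly positive sequence $w=(w_j)_{j\ge1}$: $\|f\|_w^2=\sum_{j\ge1}w_j|\langle f,\psi_j\rangle|^2$ and $\mathcal F_w=\{f\in L^2[0,1]:\|f\|_w^2<\infty\}$. $\mathcal X$ is the set of centered second order stationary random functions $X$ with $\mathbb E\|X\|^2<\infty$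 and strictly positive covariance operator. For $k\in\mathbb N$, $\eta\ge1$: $\mathcal X^k_\eta$ is the set of $X\in\mathcal X$ with $\sup_{j\in\mathbb N}\mathbb E|\langle X,\psi_j\rangle/\sqrt{\lambda_j}|^k\le\eta$, and $\mathcal E^k_\eta$ is the set of centered error terms $\epsilon$ with variance one and $\mathbb E|\epsilon|^k\le\eta$. $\widehat g_j=\frac1n\sum_{i=1}^nY_i\langle X_i,\psi_j\rangle$ and $\widehat\lambda_j=\frac1n\sum_{i=1}^n\langle X_i,\psi_j\rangle^2$. *)

theory Defs
  imports "HOL-Probability.Probability"
begin

section \<open>The space of square integrable functions on the unit interval\<close>

text \<open>Elements of the Hilbert space are represented by functions, not by classes modulo equality
  almost everywhere: stationarity of a random function refers to its values at single points.\<close>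

definition L2 :: "(real \<Rightarrow> real) set" where
  "L2 = {f \<in> borel_measurable (lebesgue_on {0..1}). integrable (lebesgue_on {0..1}) (\<lambda>t. (f t)\<^sup>2)}"

definition l2_inner :: "(real \<Rightarrow> real) \<Rightarrow> (real \<Rightarrow> real) \<Rightarrow> real" where
  "l2_inner f g = (LINT t|lebesgue_on {0..1}. f t * g t)"

definition l2_norm :: "(real \<Rightarrow> real) \<Rightarrow> real" where
  "l2_norm f = sqrt (l2_inner f f)"

text \<open>The Borel sigma-algebra, generated by the open sets of the (pseudo)metric of \<open>l2_norm\<close>.\<close>

definition L2_borel :: "(real \<Rightarrow> real) measure" where
  "L2_borel = sigma L2
     {U. U \<subseteq> L2 \<and> (\<forall>f\<in>U. \<exists>e>0. \<forall>g\<in>L2. l2_norm (\<lambda>t. g t - f t) < e \<longrightarrow> g \<in> U)}"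

text \<open>All sequences are indexed by the positive integers; the value at index 0 is irrelevant.\<close>

definition psi :: "nat \<Rightarrow> real \<Rightarrow> real" where
  "psi j s =
     (if j = 1 then 1
      else if even j then sqrt 2 * cos (2 * pi * real (j div 2) * s)
      else sqrt 2 * sin (2 * pi * real (j div 2) * s))"

definition wnorm2 :: "(nat \<Rightarrow> real) \<Rightarrow> (real \<Rightarrow> real) \<Rightarrow> ennreal" where
  "wnorm2 w f = (\<Sum>j. ennreal (w (Suc j) * \<bar>l2_inner f (psi (Suc j))\<bar>\<^sup>2))"

definition F_space :: "(nat \<Rightarrow> real) \<Rightarrow> (real \<Rightarrow> real) set" where
  "F_space w = {f \<in> L2. wnorm2 w f < \<infinity>}"

section \<open>Random functions\<close>

text \<open>Joint measurability makes the pointwise covariance compatible with the \<open>L2\<close>-valued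
  random element.\<close>

definition random_function :: "'a measure \<Rightarrow> ('a \<Rightarrow> real \<Rightarrow> real) \<Rightarrow> bool" where
  "random_function M X \<longleftrightarrow>
     X \<in> measurable M L2_borel \<and>
     (\<lambda>(x, t). X x t) \<in> borel_measurable (M \<Otimes>\<^sub>M lebesgue_on {0..1})"

definition centered_function :: "'a measure \<Rightarrow> ('a \<Rightarrow> real \<Rightarrow> real) \<Rightarrow> bool" where
  "centered_function M X \<longleftrightarrow>
     (\<forall>f\<in>L2. integrable M (\<lambda>x. l2_inner (X x) f) \<and> (LINT x|M. l2_inner (X x) f) = 0)"

definition Cov :: "'a measure \<Rightarrow> ('a \<Rightarrow> real) \<Rightarrow> ('a \<Rightarrow> real) \<Rightarrow> real" where
  "Cov M U V = (LINT x|M. (U x - (LINT y|M. U y)) * (V x - (LINT y|M. V y)))"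

text \<open>Positive definiteness in Bochner's (non-strict) sense; only values of \<open>c\<close> on \<open>[-1,1]\<close> occur.\<close>

definition positive_definite_fun :: "(real \<Rightarrow> real) \<Rightarrow> bool" where
  "positive_definite_fun c \<longleftrightarrow>
     (\<forall>h\<in>{-1..1}. c (- h) = c h) \<and>
     (\<forall>S a. finite S \<and> S \<subseteq> {0..1} \<longrightarrow> (\<Sum>s\<in>S. \<Sum>t\<in>S. a s * a t * c (t - s)) \<ge> 0)"

definition second_order_stationary :: "'a measure \<Rightarrow> ('a \<Rightarrow> real \<Rightarrow> real) \<Rightarrow> bool" where
  "second_order_stationary M X \<longleftrightarrow>
     (\<forall>t\<in>{0..1}. integrable M (\<lambda>x. (X x t)\<^sup>2)) \<and>
     (\<exists>c. positive_definite_fun c \<and>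
        (\<forall>s\<in>{0..1}. \<forall>t\<in>{0..1}. Cov M (\<lambda>x. X x t) (\<lambda>x. X x s) = c (t - s)))"

definition cov_op :: "'a measure \<Rightarrow> ('a \<Rightarrow> real \<Rightarrow> real) \<Rightarrow> (real \<Rightarrow> real) \<Rightarrow> real \<Rightarrow> real" where
  "cov_op M X f s = (LINT t|lebesgue_on {0..1}. Cov M (\<lambda>x. X x t) (\<lambda>x. X x s) * f t)"

definition strictly_positive_op :: "((real \<Rightarrow> real) \<Rightarrow> real \<Rightarrow> real) \<Rightarrow> bool" where
  "strictly_positive_op T \<longleftrightarrow> (\<forall>f\<in>L2. l2_norm f \<noteq> 0 \<longrightarrow> l2_inner (T f) f > 0)"

definition eigval :: "'a measure \<Rightarrow> ('a \<Rightarrow> real \<Rightarrow> real) \<Rightarrow> nat \<Rightarrow> real" where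
  "eigval M X j = (LINT x|M. (l2_inner (X x) (psi j))\<^sup>2)"

text \<open>Stationarity alone does not make the trigonometric functions eigenfunctions of the covariance
  operator (unless \<open>c\<close> is 1-periodic), so this is a separate requirement. The equation
  is one between elements of the Hilbert space, hence almost everywhere.\<close>

definition diagonal_in_trig_basis :: "'a measure \<Rightarrow> ('a \<Rightarrow> real \<Rightarrow> real) \<Rightarrow> bool" where
  "diagonal_in_trig_basis M X \<longleftrightarrow>
     (\<forall>j\<ge>1. eigval M X j > 0 \<and>
        (AE s in lebesgue_on {0..1}. cov_op M X (psi j) s = eigval M X j * psi j s))"

definition X_class :: "'a measure \<Rightarrow> ('a \<Rightarrow> real \<Rightarrow> real) set" where
  "X_class M = {X. random_function M X \<and> centered_function M X \<and> second_order_stationary M X \<and>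
     (\<integral>\<^sup>+x. ennreal ((l2_norm (X x))\<^sup>2) \<partial>M) < \<infinity> \<and> strictly_positive_op (cov_op M X)}"

definition X_moment_class :: "'a measure \<Rightarrow> nat \<Rightarrow> real \<Rightarrow> ('a \<Rightarrow> real \<Rightarrow> real) set" where
  "X_moment_class M k \<eta> = {X \<in> X_class M.
     (SUP j\<in>{1..}. \<integral>\<^sup>+x. ennreal (\<bar>l2_inner (X x) (psi j) / sqrt (eigval M X j)\<bar> ^ k) \<partial>M)
       \<le> ennreal \<eta>}"

definition error_moment_class :: "'a measure \<Rightarrow> nat \<Rightarrow> real \<Rightarrow> ('a \<Rightarrow> real) set" where
  "error_moment_class M k \<eta> = {\<epsilon> \<in> borel_measurable M.
     integrable M (\<lambda>x. (\<epsilon> x)\<^sup>2) \<and> (LINT x|M. \<epsilon> x) = 0 \<and> Cov M \<epsilon> \<epsilon> = 1 \<and>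
     (\<integral>\<^sup>+x. ennreal (\<bar>\<epsilon> x\<bar> ^ k) \<partial>M) \<le> ennreal \<eta>}"

section \<open>The functional linear model, samples and the estimator\<close>

definition functional_linear_model ::
  "'a measure \<Rightarrow> (real \<Rightarrow> real) \<Rightarrow> real \<Rightarrow> ('a \<Rightarrow> real) \<Rightarrow> ('a \<Rightarrow> real \<Rightarrow> real) \<Rightarrow> ('a \<Rightarrow> real) \<Rightarrow> bool"
where
  "functional_linear_model M \<beta> \<sigma> Y X \<epsilon> \<longleftrightarrow>
     Y \<in> borel_measurable M \<and>
     (\<forall>f\<in>L2. (LINT x|M. \<epsilon> x * l2_inner (X x) f) = 0) \<and>
     (AE x in M. Y x = (LINT t|lebesgue_on {0..1}. \<beta> t * X x t) + \<sigma> * \<epsilon> x)"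

definition iid_sample ::
  "'b measure \<Rightarrow> nat \<Rightarrow> (nat \<Rightarrow> 'b \<Rightarrow> real) \<Rightarrow> (nat \<Rightarrow> 'b \<Rightarrow> real \<Rightarrow> real) \<Rightarrow>
   'a measure \<Rightarrow> ('a \<Rightarrow> real) \<Rightarrow> ('a \<Rightarrow> real \<Rightarrow> real) \<Rightarrow> bool"
where
  "iid_sample P n Ys Xs M Y X \<longleftrightarrow>
     prob_space P \<and>
     prob_space.indep_vars P (\<lambda>_. borel \<Otimes>\<^sub>M L2_borel) (\<lambda>i x. (Ys i x, Xs i x)) {1..n} \<and>
     (\<forall>i\<in>{1..n}. distr P (borel \<Otimes>\<^sub>M L2_borel) (\<lambda>x. (Ys i x, Xs i x)) =
                 distr M (borel \<Otimes>\<^sub>M L2_borel) (\<lambda>x. (Y x, X x)))"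

definition g_hat ::
  "nat \<Rightarrow> (nat \<Rightarrow> 'b \<Rightarrow> real) \<Rightarrow> (nat \<Rightarrow> 'b \<Rightarrow> real \<Rightarrow> real) \<Rightarrow> nat \<Rightarrow> 'b \<Rightarrow> real" where
  "g_hat n Ys Xs j x = (1 / real n) * (\<Sum>i=1..n. Ys i x * l2_inner (Xs i x) (psi j))"

definition lambda_hat :: "nat \<Rightarrow> (nat \<Rightarrow> 'b \<Rightarrow> real \<Rightarrow> real) \<Rightarrow> nat \<Rightarrow> 'b \<Rightarrow> real" where
  "lambda_hat n Xs j x = (1 / real n) * (\<Sum>i=1..n. (l2_inner (Xs i x) (psi j))\<^sup>2)"

definition beta_hat ::
  "nat \<Rightarrow> nat \<Rightarrow> real \<Rightarrow> (nat \<Rightarrow> 'b \<Rightarrow> real) \<Rightarrow> (nat \<Rightarrow> 'b \<Rightarrow> real \<Rightarrow> real) \<Rightarrow> 'b \<Rightarrow> real \<Rightarrow> real" where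
  "beta_hat n m \<alpha> Ys Xs x s =
     (\<Sum>j=1..m. g_hat n Ys Xs j x / lambda_hat n Xs j x
                 * of_bool (lambda_hat n Xs j x \<ge> \<alpha>) * psi j s)"

end

theory Submission
  imports Defs
begin

text \<open>Write \<open>b\<^sub>j\<close> for the Fourier coefficients of \<open>\<beta>\<close>, \<open>\<xi>\<^sub>j\<close> for those of \<open>X\<close> and \<open>\<lambda>\<^sub>j = E \<xi>\<^sub>j\<^sup>2\<close>. Since \<open>\<psi>\<^sub>j\<close> is an eigenfunction of
  the covariance operator and \<open>\<epsilon>\<close> is uncorrelated with \<open>X\<close>, Fubini's theorem gives \<open>E(Y \<xi>\<^sub>j) = \<lambda>\<^sub>j b\<^sub>j\<close>
  (\<open>expectation_\<xi>_inner\<close>). Hence the score \<open>(Y - b\<^sub>j \<xi>\<^sub>j) \<xi>\<^sub>j\<close> is centered, and its sample mean is exactly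
  \<open>g\<^sub>j - b\<^sub>j l\<^sub>j\<close>, where \<open>g\<^sub>j\<close> and \<open>l\<^sub>j\<close> are the estimators of \<open>\<lambda>\<^sub>j b\<^sub>j\<close> and \<open>\<lambda>\<^sub>j\<close>. The coefficient of the
  estimator is \<open>g\<^sub>j / l\<^sub>j\<close> if \<open>l\<^sub>j \<ge> \<alpha>\<close> and \<open>0\<close> otherwise, so its squared error is at most
  \<open>(g\<^sub>j - b\<^sub>j l\<^sub>j)\<^sup>2 / \<alpha>\<^sup>2\<close> in the first case and \<open>b\<^sub>j\<^sup>2\<close> in the second. With \<open>W = sup\<^sub>j\<^sub>\<le>\<^sub>m \<omega>\<^sub>j\<close> this bounds the
  risk by
  \<open>W / (n \<alpha>\<^sup>2) * (sum over j \<le> m of the variances of the scores)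
    + (sum over j \<le> m of \<omega>\<^sub>j b\<^sub>j\<^sup>2 P(l\<^sub>j < \<alpha>)) + (sum over j > m of \<omega>\<^sub>j b\<^sub>j\<^sup>2)\<close>
  (\<open>risk_le\<close>).

  The first term vanishes because the variances of all scores together are finite. By Bessel's inequality
  the sum of the squared scores is at most \<open>2 (Y\<^sup>2 + \<parallel>\<beta>\<parallel>\<^sup>2 \<parallel>X\<parallel>\<^sup>2) \<parallel>X\<parallel>\<^sup>2\<close> for every \<open>m\<close>
  (\<open>sum_score_squares_le\<close>), which is integrable once \<open>E\<parallel>X\<parallel>\<^sup>4\<close> is finite. The moment condition controls only the
  coefficients \<open>\<xi>\<^sub>j\<close>; it controls \<open>\<parallel>X\<parallel>\<close> because Parseval's identity says \<open>\<parallel>X\<parallel>\<^sup>2 = \<Sum>\<^sub>j \<xi>\<^sub>j\<^sup>2\<close>, and the weighted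
  Cauchy-Schwarz inequality \<open>(\<Sum>\<^sub>j \<xi>\<^sub>j\<^sup>2)\<^sup>2 \<le> (\<Sum>\<^sub>j \<lambda>\<^sub>j) (\<Sum>\<^sub>j \<xi>\<^sub>j\<^sup>4 / \<lambda>\<^sub>j)\<close> then gives \<open>E\<parallel>X\<parallel>\<^sup>4 \<le> \<eta> (E\<parallel>X\<parallel>\<^sup>2)\<^sup>2\<close>. Parseval's
  identity is the completeness of the trigonometric system, which comes from the Stone-Weierstrass theorem
  on the unit circle.

  The other two terms form one series whose \<open>j\<close>-th term is dominated by \<open>\<omega>\<^sub>j b\<^sub>j\<^sup>2\<close>. Now \<open>\<omega> \<le> \<gamma>\<close>, because
  \<open>\<gamma> / \<omega>\<close> is nondecreasing and starts at \<open>1\<close>, so the dominating series converges. Each single term tends to \<open>0\<close>: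
  eventually \<open>j \<le> m\<close> and \<open>\<alpha> < \<lambda>\<^sub>j / 2\<close>, and then Chebyshev's inequality bounds \<open>P(l\<^sub>j < \<alpha>)\<close> by a multiple of \<open>1 / n\<close>.
  Tannery's theorem (dominated convergence for series) concludes.\<close>

section \<open>The pseudo inner product space of square integrable functions\<close>

abbreviation unit_leb :: "real measure" where
  "unit_leb \<equiv> lebesgue_on {0..1}"

lemma space_unit_leb [simp]: "space unit_leb = {0..1}"
  by (simp add: space_restrict_space)

lemma finite_measure_unit_leb: "finite_measure unit_leb"
  by (rule finite_measure_lebesgue_on) auto

lemma L2_borel_measurable: "f \<in> L2 \<Longrightarrow> f \<in> borel_measurable unit_leb"
  by (simp add: L2_def)

lemma L2_square_integrable: "f \<in> L2 \<Longrightarrow> integrable unit_leb (\<lambda>t. (f t)\<^sup>2)"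
  by (simp add: L2_def)

lemma abs_mult_le_sum_squares: "\<bar>a * b\<bar> \<le> a\<^sup>2 + b\<^sup>2" for a b :: real
proof -
  have "0 \<le> (\<bar>a\<bar> - \<bar>b\<bar>)\<^sup>2" by simp
  then have "2 * (\<bar>a\<bar> * \<bar>b\<bar>) \<le> a\<^sup>2 + b\<^sup>2" by (simp add: power2_diff)
  moreover have "0 \<le> \<bar>a\<bar> * \<bar>b\<bar>" by simp
  ultimately show ?thesis unfolding abs_mult by linarith
qed

lemma integrable_mult_of_squares:
  fixes u v :: "'a \<Rightarrow> real"
  assumes "u \<in> borel_measurable M" "v \<in> borel_measurable M"
    and "integrable M (\<lambda>x. (u x)\<^sup>2)" "integrable M (\<lambda>x. (v x)\<^sup>2)"
  shows "integrable M (\<lambda>x. u x * v x)"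
proof (rule Bochner_Integration.integrable_bound)
  show "integrable M (\<lambda>x. (u x)\<^sup>2 + (v x)\<^sup>2)"
    using assms by simp
  show "(\<lambda>x. u x * v x) \<in> borel_measurable M"
    using assms by simp
  show "AE x in M. norm (u x * v x) \<le> norm ((u x)\<^sup>2 + (v x)\<^sup>2)"
    using abs_mult_le_sum_squares by simp
qed

lemma L2_mult_integrable:
  assumes "f \<in> L2" "g \<in> L2"
  shows "integrable unit_leb (\<lambda>t. f t * g t)"
  using assms by (intro integrable_mult_of_squares L2_borel_measurable L2_square_integrable)

lemma L2_scale: "f \<in> L2 \<Longrightarrow> (\<lambda>t. c * f t) \<in> L2"
  unfolding L2_def by (auto simp: power_mult_distrib)

lemma L2_add:
  assumes "f \<in> L2" "g \<in> L2"
  shows "(\<lambda>t. f t + g t) \<in> L2"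
proof -
  have "integrable unit_leb (\<lambda>t. (f t)\<^sup>2 + (g t)\<^sup>2 + 2 * (f t * g t))"
    using assms L2_mult_integrable[OF assms] by (auto simp: L2_def)
  then have "integrable unit_leb (\<lambda>t. (f t + g t)\<^sup>2)"
    by (simp add: power2_sum mult.assoc)
  with assms show ?thesis
    by (auto simp: L2_def)
qed

lemma L2_diff:
  assumes "f \<in> L2" "g \<in> L2"
  shows "(\<lambda>t. f t - g t) \<in> L2"
  using L2_add[OF assms(1) L2_scale[OF assms(2), of "-1"]] by simp

lemma L2_bounded:
  assumes "f \<in> borel_measurable unit_leb" "\<And>t. t \<in> {0..1} \<Longrightarrow> \<bar>f t\<bar> \<le> B"
  shows "f \<in> L2"
proof -
  have "integrable unit_leb (\<lambda>t. (f t)\<^sup>2)"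
  proof (rule finite_measure.integrable_const_bound[OF finite_measure_unit_leb])
    have "(f t)\<^sup>2 \<le> B\<^sup>2" if "t \<in> {0..1}" for t
      using assms(2)[OF that] by (intro abs_le_square_iff[THEN iffD1]) auto
    then show "AE t in unit_leb. norm ((f t)\<^sup>2) \<le> B\<^sup>2"
      by (intro AE_I2) auto
  qed (use assms in auto)
  with assms show ?thesis by (simp add: L2_def)
qed

lemma L2_const: "(\<lambda>t. c) \<in> L2"
  by (rule L2_bounded[of _ "\<bar>c\<bar>"]) auto

lemma L2_sum:
  assumes "\<And>i. i \<in> I \<Longrightarrow> f i \<in> L2"
  shows "(\<lambda>t. \<Sum>i\<in>I. f i t) \<in> L2"
  using assms by (induction I rule: infinite_finite_induct) (auto intro: L2_add L2_const)

lemma l2_inner_commute: "l2_inner f g = l2_inner g f"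
  by (simp add: l2_inner_def mult.commute)

lemma l2_inner_diff:
  assumes "f \<in> L2" "g \<in> L2" "h \<in> L2"
  shows "l2_inner (\<lambda>t. f t - g t) h = l2_inner f h - l2_inner g h"
  unfolding l2_inner_def left_diff_distrib
  using assms by (intro Bochner_Integration.integral_diff L2_mult_integrable)

lemma l2_inner_scale: "l2_inner (\<lambda>t. c * f t) h = c * l2_inner f h"
  by (simp add: l2_inner_def mult.assoc)

lemma l2_inner_sum:
  assumes "\<And>i. i \<in> I \<Longrightarrow> f i \<in> L2" "h \<in> L2"
  shows "l2_inner (\<lambda>t. \<Sum>i\<in>I. f i t) h = (\<Sum>i\<in>I. l2_inner (f i) h)"
  unfolding l2_inner_def sum_distrib_right
  using assms by (intro Bochner_Integration.integral_sum L2_mult_integrable)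

lemma l2_inner_self_nonneg: "l2_inner f f \<ge> 0"
  unfolding l2_inner_def by (intro integral_nonneg_AE) auto

lemma l2_norm_square: "(l2_norm f)\<^sup>2 = l2_inner f f"
  by (simp add: l2_norm_def l2_inner_self_nonneg)

lemma l2_norm_nonneg: "l2_norm f \<ge> 0"
  by (simp add: l2_norm_def l2_inner_self_nonneg)

lemma l2_inner_self_diff:
  assumes "f \<in> L2" "g \<in> L2"
  shows "l2_inner (\<lambda>t. f t - g t) (\<lambda>t. f t - g t) = l2_inner f f - 2 * l2_inner f g + l2_inner g g"
proof -
  have "l2_inner (\<lambda>t. f t - g t) (\<lambda>t. f t - g t)
      = l2_inner f (\<lambda>t. f t - g t) - l2_inner g (\<lambda>t. f t - g t)"
    using assms by (intro l2_inner_diff L2_diff)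
  also have "\<dots> = (l2_inner f f - l2_inner g f) - (l2_inner f g - l2_inner g g)"
    using assms by (simp add: l2_inner_commute[of _ "\<lambda>t. f t - g t"] l2_inner_diff)
  finally show ?thesis
    by (simp add: l2_inner_commute[of g f])
qed

lemma l2_Cauchy_Schwarz:
  assumes "f \<in> L2" "g \<in> L2"
  shows "\<bar>l2_inner f g\<bar> \<le> l2_norm f * l2_norm g"
proof -
  have *: "0 \<le> l2_inner f f - 2 * c * l2_inner f g + c\<^sup>2 * l2_inner g g" for c
  proof -
    have "l2_inner f (\<lambda>t. c * g t) = c * l2_inner f g"
      by (metis l2_inner_commute l2_inner_scale)
    moreover have "l2_inner (\<lambda>t. c * g t) (\<lambda>t. c * g t) = c\<^sup>2 * l2_inner g g"
      by (simp add: l2_inner_scale l2_inner_commute[of g "\<lambda>t. c * g t"] power2_eq_square)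
    ultimately show ?thesis
      using l2_inner_self_diff[OF assms(1) L2_scale[OF assms(2), of c]]
        l2_inner_self_nonneg[of "\<lambda>t. f t - c * g t"] by simp
  qed
  have "(l2_inner f g)\<^sup>2 \<le> l2_inner f f * l2_inner g g"
  proof (cases "l2_inner g g = 0")
    case True
    have "l2_inner f g = 0"
    proof (rule ccontr)
      assume ne: "l2_inner f g \<noteq> 0"
      show False
        using *[of "(l2_inner f f + 1) / (2 * l2_inner f g)"] ne True by simp
    qed
    with True show ?thesis by simp
  next
    case False
    then have pos: "l2_inner g g > 0"
      using l2_inner_self_nonneg[of g] by simp
    from *[of "l2_inner f g / l2_inner g g"] pos show ?thesis
      by (simp add: field_simps power2_eq_square)
  qed
  then have "sqrt ((l2_inner f g)\<^sup>2) \<le> sqrt (l2_inner f f * l2_inner g g)"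
    by (rule real_sqrt_le_mono)
  then show ?thesis
    by (simp add: l2_norm_def real_sqrt_mult)
qed

text \<open>Stands in for the triangle inequality: approximation arguments then run entirely with squared distances.\<close>

lemma l2_inner_self_add_le:
  assumes "f \<in> L2" "g \<in> L2"
  shows "l2_inner (\<lambda>t. f t + g t) (\<lambda>t. f t + g t) \<le> 2 * l2_inner f f + 2 * l2_inner g g"
proof -
  have "l2_inner (\<lambda>t. f t + g t) (\<lambda>t. f t + g t) \<le> (LINT t|unit_leb. 2 * (f t * f t) + 2 * (g t * g t))"
    unfolding l2_inner_def
  proof (rule integral_mono)
    show "integrable unit_leb (\<lambda>t. (f t + g t) * (f t + g t))"
      using assms by (intro L2_mult_integrable L2_add)
    show "integrable unit_leb (\<lambda>t. 2 * (f t * f t) + 2 * (g t * g t))"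
      using assms by (intro Bochner_Integration.integrable_add integrable_mult_right L2_mult_integrable)
    fix t show "(f t + g t) * (f t + g t) \<le> 2 * (f t * f t) + 2 * (g t * g t)"
      using zero_le_power2[of "f t - g t"] by (simp add: power2_eq_square algebra_simps)
  qed
  also have "\<dots> = 2 * l2_inner f f + 2 * l2_inner g g"
    unfolding l2_inner_def
    using assms by (subst Bochner_Integration.integral_add) (auto intro: L2_mult_integrable)
  finally show ?thesis .
qed

lemma integral_unit_leb_derivative:
  assumes "\<And>t. (F has_real_derivative f t) (at t)" "continuous_on {0..1} f"
  shows "(LINT t|unit_leb. f t) = F 1 - F 0"
proof -
  have "integrable unit_leb f"
    using assms by (intro continuous_imp_integrable_real)
  then have "(LINT t|unit_leb. f t) = integral {0..1} f"
    by (intro lebesgue_integral_eq_integral) auto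
  also have "\<dots> = F 1 - F 0"
    using assms(1) by (intro integral_unique fundamental_theorem_of_calculus)
      (auto simp: has_real_derivative_iff_has_vector_derivative has_vector_derivative_at_within)
  finally show ?thesis .
qed

section \<open>Orthonormality of the trigonometric functions and Bessel's inequality\<close>

lemma integral_cos_period:
  fixes k :: int
  shows "(LINT t|unit_leb. cos (2 * pi * of_int k * t)) = of_bool (k = 0)"
proof (cases "k = 0")
  case True
  then show ?thesis
    using integral_unit_leb_derivative[of "\<lambda>t. t" "\<lambda>t. 1"] by (auto intro!: derivative_eq_intros)
next
  case False
  have "(LINT t|unit_leb. cos (2 * pi * of_int k * t))
      = sin (2 * pi * of_int k * 1) / (2 * pi * of_int k) - sin (2 * pi * of_int k * 0) / (2 * pi * of_int k)"
    using False
    by (intro integral_unit_leb_derivative[of "\<lambda>t. sin (2 * pi * of_int k * t) / (2 * pi * of_int k)"])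
      (auto intro!: derivative_eq_intros continuous_intros)
  with False show ?thesis
    using sin_integer_2pi[of "of_int k"] by (simp add: mult.commute)
qed

lemma integral_sin_period:
  fixes k :: int
  shows "(LINT t|unit_leb. sin (2 * pi * of_int k * t)) = 0"
proof (cases "k = 0")
  case False
  have "(LINT t|unit_leb. sin (2 * pi * of_int k * t))
      = - cos (2 * pi * of_int k * 1) / (2 * pi * of_int k) - - cos (2 * pi * of_int k * 0) / (2 * pi * of_int k)"
    using False
    by (intro integral_unit_leb_derivative[of "\<lambda>t. - cos (2 * pi * of_int k * t) / (2 * pi * of_int k)"])
      (auto intro!: derivative_eq_intros continuous_intros)
  with False show ?thesis
    using cos_integer_2pi[of "of_int k"] by (simp add: mult.commute)
qed auto

lemma continuous_on_unit_leb_measurable: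
  "continuous_on {0..1} f \<Longrightarrow> f \<in> borel_measurable unit_leb" for f :: "real \<Rightarrow> real"
  by (rule continuous_imp_measurable_on_sets_lebesgue) auto

lemma continuous_on_L2:
  fixes f :: "real \<Rightarrow> real"
  assumes "continuous_on {0..1} f"
  shows "f \<in> L2"
proof -
  have "bounded (f ` {0..1})"
    using assms by (intro compact_imp_bounded compact_continuous_image) auto
  then obtain B where "\<forall>t\<in>{0..1}. \<bar>f t\<bar> \<le> B"
    by (auto simp: bounded_iff)
  then show ?thesis
    using assms by (intro L2_bounded[of f B] continuous_on_unit_leb_measurable) auto
qed

lemma continuous_on_psi: "continuous_on S (psi j)"
proof -
  consider "j = 1" | "j \<noteq> 1" "even j" | "j \<noteq> 1" "odd j" by blast
  then show ?thesis
    by cases (simp_all add: psi_def[abs_def] continuous_intros)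
qed

lemma psi_in_L2: "psi j \<in> L2"
  by (rule continuous_on_L2[OF continuous_on_psi])

text \<open>Products of cosines and sines of integer frequencies \<open>i\<close> and \<open>l\<close> are half sums of waves of frequencies
  \<open>i + l\<close> and \<open>i - l\<close>, and only the frequency \<open>0\<close> has a nonzero mean over a period.\<close>

lemma psi_orthonormal:
  assumes "j \<ge> 1" "k \<ge> 1"
  shows "l2_inner (psi j) (psi k) = of_bool (j = k)"
proof -
  define c where "c i t = cos (2 * pi * real_of_int i * t)" for i t
  define s where "s i t = sin (2 * pi * real_of_int i * t)" for i t
  have int_c: "integrable unit_leb (c i)" and int_s: "integrable unit_leb (s i)" for i
    unfolding c_def s_def by (auto intro!: continuous_imp_integrable_real continuous_intros)
  have c: "(LINT t|unit_leb. c i t) = of_bool (i = 0)"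
    and s: "(LINT t|unit_leb. s i t) = 0" for i
    by (simp_all only: c_def s_def integral_cos_period integral_sin_period)
  have cc: "(LINT t|unit_leb. c i t * c l t) = (of_bool (i = l) + of_bool (i + l = 0)) / 2" for i l
  proof -
    have *: "c i t * c l t = (c (i - l) t + c (i + l) t) / 2" for t
      by (simp add: c_def cos_times_cos algebra_simps)
    show ?thesis
      unfolding * using int_c c by simp
  qed
  have ss: "(LINT t|unit_leb. s i t * s l t) = (of_bool (i = l) - of_bool (i + l = 0)) / 2" for i l
  proof -
    have *: "s i t * s l t = (c (i - l) t - c (i + l) t) / 2" for t
      by (simp add: c_def s_def sin_times_sin algebra_simps)
    show ?thesis
      unfolding * using int_c c by simp
  qed
  have sc: "(LINT t|unit_leb. s i t * c l t) = 0" for i l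
  proof -
    have *: "s i t * c l t = (s (i + l) t + s (i - l) t) / 2" for t
      by (simp add: c_def s_def sin_times_cos) (simp add: algebra_simps)
    show ?thesis
      unfolding * using int_s s by simp
  qed
  have psi_c: "psi i t = sqrt 2 * c (int (i div 2)) t" if "even i" for i t
    using that by (auto simp: psi_def c_def)
  have psi_s: "psi i t = sqrt 2 * s (int (i div 2)) t" if "odd i" "i \<noteq> 1" for i t
    using that by (auto simp: psi_def s_def)
  have psi_1: "psi (Suc 0) t = c 0 t" for t
    by (simp add: psi_def c_def)
  have eq: "(sqrt 2 * x) * (sqrt 2 * y) = 2 * (x * y)" for x y :: real
    by simp
  have eq1: "x * (sqrt 2 * y) = sqrt 2 * (x * y)" for x y :: real
    by simp
  have cs: "(LINT t|unit_leb. c i t * s l t) = 0" for i l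
    using sc[of l i] by (simp add: mult.commute)
  consider "j = 1" | "even j" | "odd j" "j \<noteq> 1" by blast
  then show ?thesis
  proof cases
    case 1
    consider "k = 1" | "even k" | "odd k" "k \<noteq> 1" by blast
    then show ?thesis
    proof cases
      case 1
      with \<open>j = 1\<close> show ?thesis by (simp add: l2_inner_def psi_1 cc)
    next
      case 2
      with \<open>j = 1\<close> assms show ?thesis
        by (auto simp: l2_inner_def psi_1 psi_c cc eq1 elim!: evenE)
    next
      case 3
      with \<open>j = 1\<close> assms show ?thesis
        by (auto simp: l2_inner_def psi_1 psi_s cs eq1 elim!: oddE)
    qed
  next
    case 2
    consider "k = 1" | "even k" | "odd k" "k \<noteq> 1" by blast
    then show ?thesis
    proof cases
      case 1
      with \<open>even j\<close> assms show ?thesis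
        by (auto simp: l2_inner_def psi_1 psi_c cc mult.assoc elim!: evenE)
    next
      case 2
      with \<open>even j\<close> assms show ?thesis
        by (auto simp: l2_inner_def psi_c eq cc elim!: evenE)
    next
      case 3
      with \<open>even j\<close> assms show ?thesis
        by (auto simp: l2_inner_def psi_c psi_s eq cs)
    qed
  next
    case 3
    consider "k = 1" | "even k" | "odd k" "k \<noteq> 1" by blast
    then show ?thesis
    proof cases
      case 1
      with \<open>odd j\<close> \<open>j \<noteq> 1\<close> show ?thesis
        by (auto simp: l2_inner_def psi_1 psi_s sc mult.assoc)
    next
      case 2
      with \<open>odd j\<close> \<open>j \<noteq> 1\<close> show ?thesis
        by (auto simp: l2_inner_def psi_c psi_s eq sc)
    next
      case 3
      with \<open>odd j\<close> \<open>j \<noteq> 1\<close> show ?thesis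
        by (auto simp: l2_inner_def psi_s eq ss elim!: oddE)
    qed
  qed
qed

lemma l2_inner_psi_combination:
  assumes "k \<ge> 1"
  shows "l2_inner (\<lambda>t. \<Sum>j=1..N. a j * psi j t) (psi k) = (if k \<le> N then a k else 0)"
proof -
  have "l2_inner (\<lambda>t. \<Sum>j=1..N. a j * psi j t) (psi k) = (\<Sum>j=1..N. a j * l2_inner (psi j) (psi k))"
    by (simp add: l2_inner_sum L2_scale psi_in_L2 l2_inner_scale)
  also have "\<dots> = (\<Sum>j=1..N. if j = k then a k else 0)"
    using assms by (intro sum.cong) (auto simp: psi_orthonormal)
  also have "\<dots> = (if k \<le> N then a k else 0)"
    using assms by (simp add: sum.delta)
  finally show ?thesis .
qed

text \<open>Completing the square in the coefficients. With \<open>a\<close> the Fourier coefficients it is Bessel's inequality;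
  with arbitrary \<open>a\<close> it says that no other combination is closer to \<open>f\<close>, which reduces Parseval's
  identity to the density of trigonometric polynomials.\<close>

lemma l2_distance_psi_combination:
  assumes "f \<in> L2"
  shows "l2_inner (\<lambda>t. f t - (\<Sum>j=1..N. a j * psi j t)) (\<lambda>t. f t - (\<Sum>j=1..N. a j * psi j t))
    = l2_inner f f - (\<Sum>j=1..N. (l2_inner f (psi j))\<^sup>2) + (\<Sum>j=1..N. (a j - l2_inner f (psi j))\<^sup>2)"
proof -
  define p where "p = (\<lambda>t. \<Sum>j=1..N. a j * psi j t)"
  have p: "p \<in> L2"
    unfolding p_def by (intro L2_sum L2_scale psi_in_L2)
  have inner_p: "l2_inner p h = (\<Sum>j=1..N. a j * l2_inner (psi j) h)" if "h \<in> L2" for h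
    unfolding p_def using that by (simp add: l2_inner_sum L2_scale psi_in_L2 l2_inner_scale)
  have fp: "l2_inner f p = (\<Sum>j=1..N. a j * l2_inner f (psi j))"
    using inner_p[OF assms] by (simp add: l2_inner_commute)
  have "l2_inner p p = (\<Sum>j=1..N. a j * l2_inner p (psi j))"
    using inner_p[OF p] by (simp add: l2_inner_commute)
  also have "\<dots> = (\<Sum>j=1..N. (a j)\<^sup>2)"
    unfolding p_def
    by (intro sum.cong refl, subst l2_inner_psi_combination) (auto simp: power2_eq_square)
  finally have "l2_inner (\<lambda>t. f t - p t) (\<lambda>t. f t - p t)
     = l2_inner f f - 2 * (\<Sum>j=1..N. a j * l2_inner f (psi j)) + (\<Sum>j=1..N. (a j)\<^sup>2)"
    using l2_inner_self_diff[OF assms p] fp by simp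
  also have "\<dots> = l2_inner f f - (\<Sum>j=1..N. (l2_inner f (psi j))\<^sup>2) + (\<Sum>j=1..N. (a j - l2_inner f (psi j))\<^sup>2)"
    by (simp add: power2_diff sum.distrib sum_subtractf sum_distrib_left algebra_simps)
  finally show ?thesis
    by (simp add: p_def)
qed

lemma Bessel_inequality:
  assumes "f \<in> L2"
  shows "(\<Sum>j=1..N. (l2_inner f (psi j))\<^sup>2) \<le> l2_inner f f"
  using l2_distance_psi_combination[OF assms, of "\<lambda>j. l2_inner f (psi j)" N]
    l2_inner_self_nonneg[of "\<lambda>t. f t - (\<Sum>j=1..N. l2_inner f (psi j) * psi j t)"]
  by simp

section \<open>Completeness of the trigonometric system\<close>

text \<open>Frequencies are integers of either sign, so that the product formulas need no distinction between
  \<open>k \<ge> l\<close> and \<open>k < l\<close>, and constants arise from \<open>cos 0\<close>.\<close>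

inductive trig_poly :: "(real \<Rightarrow> real) \<Rightarrow> bool" where
  trig_poly_cos: "trig_poly (\<lambda>t. cos (2 * pi * of_int k * t))"
| trig_poly_sin: "trig_poly (\<lambda>t. sin (2 * pi * of_int k * t))"
| trig_poly_scale: "trig_poly p \<Longrightarrow> trig_poly (\<lambda>t. c * p t)"
| trig_poly_add: "trig_poly p \<Longrightarrow> trig_poly q \<Longrightarrow> trig_poly (\<lambda>t. p t + q t)"

lemma trig_poly_mult_cos:
  "trig_poly q \<Longrightarrow> trig_poly (\<lambda>t. cos (2 * pi * of_int k * t) * q t)"
proof (induction rule: trig_poly.induct)
  case (trig_poly_cos l)
  have "trig_poly (\<lambda>t. (1/2) * cos (2 * pi * of_int (k - l) * t) + (1/2) * cos (2 * pi * of_int (k + l) * t))"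
    by (intro trig_poly.intros)
  then show ?case
    by (simp add: cos_times_cos add_divide_distrib) (simp add: algebra_simps)
next
  case (trig_poly_sin l)
  have "trig_poly (\<lambda>t. (1/2) * sin (2 * pi * of_int (k + l) * t) + (-1/2) * sin (2 * pi * of_int (k - l) * t))"
    by (intro trig_poly.intros)
  then show ?case
    by (simp add: cos_times_sin diff_divide_distrib) (simp add: algebra_simps)
next
  case (trig_poly_scale p c)
  then show ?case
    using trig_poly.trig_poly_scale[OF trig_poly_scale.IH, of c] by (simp add: mult.left_commute)
next
  case (trig_poly_add p q)
  then show ?case
    using trig_poly.trig_poly_add[OF trig_poly_add.IH] by (simp add: distrib_left)
qed

lemma trig_poly_mult_sin:
  "trig_poly q \<Longrightarrow> trig_poly (\<lambda>t. sin (2 * pi * of_int k * t) * q t)"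
proof (induction rule: trig_poly.induct)
  case (trig_poly_cos l)
  have "trig_poly (\<lambda>t. (1/2) * sin (2 * pi * of_int (k + l) * t) + (1/2) * sin (2 * pi * of_int (k - l) * t))"
    by (intro trig_poly.intros)
  then show ?case
    by (simp add: sin_times_cos add_divide_distrib) (simp add: algebra_simps)
next
  case (trig_poly_sin l)
  have "trig_poly (\<lambda>t. (1/2) * cos (2 * pi * of_int (k - l) * t) + (-1/2) * cos (2 * pi * of_int (k + l) * t))"
    by (intro trig_poly.intros)
  then show ?case
    by (simp add: sin_times_sin diff_divide_distrib) (simp add: algebra_simps)
next
  case (trig_poly_scale p c)
  then show ?case
    using trig_poly.trig_poly_scale[OF trig_poly_scale.IH, of c] by (simp add: mult.left_commute)
next
  case (trig_poly_add p q)
  then show ?case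
    using trig_poly.trig_poly_add[OF trig_poly_add.IH] by (simp add: distrib_left)
qed

lemma trig_poly_mult:
  assumes "trig_poly p" "trig_poly q"
  shows "trig_poly (\<lambda>t. p t * q t)"
  using assms
proof (induction rule: trig_poly.induct)
  case (trig_poly_scale p c)
  then show ?case
    using trig_poly.trig_poly_scale[of "\<lambda>t. p t * q t" c] by (simp add: mult.assoc)
next
  case (trig_poly_add p p')
  then show ?case
    using trig_poly.trig_poly_add[of "\<lambda>t. p t * q t" "\<lambda>t. p' t * q t"] by (simp add: distrib_right)
qed (simp_all add: trig_poly_mult_cos trig_poly_mult_sin)

text \<open>This connects to the Stone-Weierstrass theorem for polynomials on the compact set \<open>sphere 0 1\<close>: a linear
  functional on the plane restricts to \<open>a cos + b sin\<close> on the circle, and trigonometric polynomials are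
  closed under sums and products.\<close>

lemma trig_poly_of_polynomial_on_circle:
  fixes p :: "complex \<Rightarrow> real"
  assumes "real_polynomial_function p"
  shows "trig_poly (\<lambda>t. p (cis (2 * pi * t)))"
  using assms
proof (induction rule: real_polynomial_function.induct)
  case (linear f)
  then interpret bounded_linear f .
  have "f (cis x) = f 1 * cos x + f \<i> * sin x" for x
  proof -
    have "cis x = cos x *\<^sub>R 1 + sin x *\<^sub>R \<i>"
      by (simp add: complex_eq_iff)
    then have "f (cis x) = f (cos x *\<^sub>R 1 + sin x *\<^sub>R \<i>)" by simp
    also have "\<dots> = f 1 * cos x + f \<i> * sin x"
      unfolding add scaleR by simp
    finally show ?thesis .
  qed
  moreover have "trig_poly (\<lambda>t. f 1 * cos (2 * pi * of_int 1 * t) + f \<i> * sin (2 * pi * of_int 1 * t))"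
    by (intro trig_poly.intros)
  ultimately show ?case
    by simp
next
  case (const c)
  have "trig_poly (\<lambda>t. c * cos (2 * pi * of_int 0 * t))"
    by (intro trig_poly.intros)
  then show ?case by simp
qed (auto intro: trig_poly_add trig_poly_mult)

text \<open>The representation is required for all lengths \<open>n \<ge> N\<close>, the coefficients beyond \<open>N\<close> being zero,
  so that two of them can be brought to a common length and added.\<close>

lemma trig_poly_psi_combination:
  assumes "trig_poly p"
  shows "\<exists>a N. \<forall>n\<ge>N. \<forall>t. p t = (\<Sum>j=1..n. a j * psi j t)"
  using assms
proof (induction rule: trig_poly.induct)
  have single: "\<exists>a N. \<forall>n\<ge>N. \<forall>t. p t = (\<Sum>i=1..n. a i * psi i t)"
    if j: "j \<ge> 1" and p: "\<And>t. p t = c * psi j t" for p j c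
  proof (intro exI allI impI)
    fix n t assume "n \<ge> j"
    have "(\<Sum>i=1..n. (if i = j then c else 0) * psi i t) = (\<Sum>i=1..n. if i = j then c * psi j t else 0)"
      by (intro sum.cong) auto
    with j \<open>n \<ge> j\<close> p show "p t = (\<Sum>i=1..n. (if i = j then c else 0) * psi i t)"
      by (simp add: sum.delta)
  qed
  {
    case (trig_poly_cos k)
    show ?case
    proof (cases "k = 0")
      case True
      then show ?thesis by (intro single[of 1 _ 1]) (simp_all add: psi_def)
    next
      case False
      have "cos (2 * pi * of_int k * t) = cos (2 * pi * real (nat \<bar>k\<bar>) * t)" for t
        by (cases "k \<ge> 0") simp_all
      with False show ?thesis
        by (intro single[of "2 * nat \<bar>k\<bar>" _ "1 / sqrt 2"]) (simp_all add: psi_def)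
    qed
  next
    case (trig_poly_sin k)
    show ?case
    proof (cases "k = 0")
      case True
      then show ?thesis by (intro single[of 1 _ 0]) (simp_all add: psi_def)
    next
      case False
      have "sin (2 * pi * of_int k * t) = of_int (sgn k) * sin (2 * pi * real (nat \<bar>k\<bar>) * t)" for t
        using False by (cases "k > 0") simp_all
      with False show ?thesis
        by (intro single[of "2 * nat \<bar>k\<bar> + 1" _ "of_int (sgn k) / sqrt 2"]) (simp_all add: psi_def)
    qed
  next
    case (trig_poly_scale p c)
    then obtain a N where *: "\<And>n t. n \<ge> N \<Longrightarrow> p t = (\<Sum>j=1..n. a j * psi j t)" by blast
    show ?case
      by (intro exI[of _ "\<lambda>j. c * a j"] exI[of _ N] allI impI, subst *)
        (auto simp: sum_distrib_left mult.assoc)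
  next
    case (trig_poly_add p q)
    then obtain a N b N' where *: "\<And>n t. n \<ge> N \<Longrightarrow> p t = (\<Sum>j=1..n. a j * psi j t)"
      "\<And>n t. n \<ge> N' \<Longrightarrow> q t = (\<Sum>j=1..n. b j * psi j t)" by blast
    have "p t + q t = (\<Sum>j=1..n. (a j + b j) * psi j t)" if "n \<ge> max N N'" for n t
      using *(1)[of n t] *(2)[of n t] that by (simp add: distrib_right sum.distrib)
    then show ?case
      by (intro exI[of _ "\<lambda>j. a j + b j"] exI[of _ "max N N'"] allI impI)
  }
qed

lemma trig_poly_continuous: "trig_poly p \<Longrightarrow> continuous_on S p"
  by (induction rule: trig_poly.induct) (auto intro!: continuous_intros)

lemma trig_poly_L2: "trig_poly p \<Longrightarrow> p \<in> L2"
  by (intro continuous_on_L2 trig_poly_continuous)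

definition trig_approximable :: "(real \<Rightarrow> real) \<Rightarrow> bool" where
  "trig_approximable f \<longleftrightarrow> f \<in> L2 \<and>
     (\<forall>e>0. \<exists>p. trig_poly p \<and> l2_inner (\<lambda>t. f t - p t) (\<lambda>t. f t - p t) < e)"

lemma trig_approximable_L2: "trig_approximable f \<Longrightarrow> f \<in> L2"
  by (simp add: trig_approximable_def)

lemma trig_approximable_limit:
  assumes "f \<in> L2"
    and "\<And>e. e > 0 \<Longrightarrow> \<exists>g. trig_approximable g \<and> l2_inner (\<lambda>t. f t - g t) (\<lambda>t. f t - g t) < e"
  shows "trig_approximable f"
  unfolding trig_approximable_def
proof (intro conjI allI impI)
  fix e :: real assume "e > 0"
  then obtain g where g: "trig_approximable g" "l2_inner (\<lambda>t. f t - g t) (\<lambda>t. f t - g t) < e / 4"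
    using assms(2)[of "e / 4"] by auto
  then obtain p where p: "trig_poly p" "l2_inner (\<lambda>t. g t - p t) (\<lambda>t. g t - p t) < e / 4"
    using \<open>e > 0\<close> unfolding trig_approximable_def by (meson divide_pos_pos zero_less_numeral)
  have "l2_inner (\<lambda>t. f t - p t) (\<lambda>t. f t - p t)
      \<le> 2 * l2_inner (\<lambda>t. f t - g t) (\<lambda>t. f t - g t) + 2 * l2_inner (\<lambda>t. g t - p t) (\<lambda>t. g t - p t)"
    using l2_inner_self_add_le[OF L2_diff[OF assms(1) trig_approximable_L2[OF g(1)]]
        L2_diff[OF trig_approximable_L2[OF g(1)] trig_poly_L2[OF p(1)]]] by simp
  with g(2) p(2) have "l2_inner (\<lambda>t. f t - p t) (\<lambda>t. f t - p t) < e" by simp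
  with p(1) show "\<exists>p. trig_poly p \<and> l2_inner (\<lambda>t. f t - p t) (\<lambda>t. f t - p t) < e" by blast
qed (fact assms(1))

lemma trig_approximable_scale:
  assumes "trig_approximable f"
  shows "trig_approximable (\<lambda>t. c * f t)"
  unfolding trig_approximable_def
proof (intro conjI allI impI)
  show "(\<lambda>t. c * f t) \<in> L2"
    using assms by (intro L2_scale trig_approximable_L2)
  fix e :: real assume "e > 0"
  then have "e / (c\<^sup>2 + 1) > 0" by (simp add: add_nonneg_pos)
  then obtain p where p: "trig_poly p" "l2_inner (\<lambda>t. f t - p t) (\<lambda>t. f t - p t) < e / (c\<^sup>2 + 1)"
    using assms unfolding trig_approximable_def by blast
  have "l2_inner (\<lambda>t. c * f t - c * p t) (\<lambda>t. c * f t - c * p t) = c\<^sup>2 * l2_inner (\<lambda>t. f t - p t) (\<lambda>t. f t - p t)"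
    by (simp add: l2_inner_def right_diff_distrib[symmetric] power2_eq_square ac_simps)
  also have "\<dots> \<le> (c\<^sup>2 + 1) * l2_inner (\<lambda>t. f t - p t) (\<lambda>t. f t - p t)"
    by (intro mult_right_mono l2_inner_self_nonneg) simp
  also have "\<dots> < e"
    using p(2) by (simp add: pos_less_divide_eq add_nonneg_pos mult.commute)
  finally show "\<exists>q. trig_poly q \<and> l2_inner (\<lambda>t. c * f t - q t) (\<lambda>t. c * f t - q t) < e"
    using trig_poly_scale[OF p(1)] by blast
qed

lemma trig_approximable_add:
  assumes "trig_approximable f" "trig_approximable g"
  shows "trig_approximable (\<lambda>t. f t + g t)"
  unfolding trig_approximable_def
proof (intro conjI allI impI)
  note L2 = assms[THEN trig_approximable_L2]
  show "(\<lambda>t. f t + g t) \<in> L2"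
    using L2 by (rule L2_add)
  fix e :: real assume "e > 0"
  then have "e / 4 > 0" by simp
  then obtain p q where p: "trig_poly p" "l2_inner (\<lambda>t. f t - p t) (\<lambda>t. f t - p t) < e / 4"
    and q: "trig_poly q" "l2_inner (\<lambda>t. g t - q t) (\<lambda>t. g t - q t) < e / 4"
    using assms unfolding trig_approximable_def by blast
  have "l2_inner (\<lambda>t. (f t + g t) - (p t + q t)) (\<lambda>t. (f t + g t) - (p t + q t)) < e"
    using l2_inner_self_add_le[OF L2_diff[OF L2(1) trig_poly_L2[OF p(1)]] L2_diff[OF L2(2) trig_poly_L2[OF q(1)]]]
      p(2) q(2) by (simp add: algebra_simps)
  with trig_poly_add[OF p(1) q(1)]
  show "\<exists>p. trig_poly p \<and> l2_inner (\<lambda>t. f t + g t - p t) (\<lambda>t. f t + g t - p t) < e" by blast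
qed

lemma trig_approximable_zero: "trig_approximable (\<lambda>t. 0)"
proof -
  have "trig_poly (\<lambda>t. 0 * cos (2 * pi * of_int 0 * t))"
    by (intro trig_poly.intros)
  then have "trig_poly (\<lambda>t. 0)" by simp
  then show ?thesis
    unfolding trig_approximable_def using L2_const[of 0] by (auto simp: l2_inner_def intro!: exI[of _ "\<lambda>t. 0"])
qed

lemma trig_approximable_sum:
  assumes "\<And>i. i \<in> I \<Longrightarrow> trig_approximable (f i)"
  shows "trig_approximable (\<lambda>t. \<Sum>i\<in>I. f i t)"
  using assms
  by (induction I rule: infinite_finite_induct) (auto intro: trig_approximable_add trig_approximable_zero)

lemma measure_unit_leb: "A \<in> sets unit_leb \<Longrightarrow> measure unit_leb A = measure lebesgue A"
  by (rule measure_restrict_space) (auto simp: sets_restrict_space)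

lemma l2_inner_self_le_bound:
  assumes "h \<in> L2" "\<And>t. t \<in> {0..1} \<Longrightarrow> \<bar>h t\<bar> \<le> d"
  shows "l2_inner h h \<le> d\<^sup>2"
proof -
  have "l2_inner h h \<le> (LINT t|unit_leb. d\<^sup>2)"
    unfolding l2_inner_def
  proof (rule integral_mono)
    show "integrable unit_leb (\<lambda>t. h t * h t)"
      by (rule L2_mult_integrable[OF assms(1) assms(1)])
    fix t assume "t \<in> space unit_leb"
    then have "\<bar>h t\<bar>\<^sup>2 \<le> d\<^sup>2"
      using assms(2)[of t] by (intro power_mono) auto
    then show "h t * h t \<le> d\<^sup>2" by (simp add: power2_eq_square)
  qed (simp add: finite_measure.integrable_const finite_measure_unit_leb)
  also have "\<dots> = d\<^sup>2"
    using measure_unit_leb[of "{0..1}"] by (simp add: sets_restrict_space_iff)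
  finally show ?thesis .
qed

text \<open>Uniform approximation on the circle is stronger than approximation in \<open>L2\<close>, since the interval
  has measure one.\<close>

lemma trig_approximable_continuous_on_circle:
  fixes F :: "complex \<Rightarrow> real"
  assumes "continuous_on (sphere 0 1) F"
  shows "trig_approximable (\<lambda>t. F (cis (2 * pi * t)))"
  unfolding trig_approximable_def
proof (intro conjI allI impI)
  have "continuous_on {0..1} (\<lambda>t. F (cis (2 * pi * t)))"
    by (rule continuous_on_compose2[OF assms]) (auto intro!: continuous_intros)
  then show L2: "(\<lambda>t. F (cis (2 * pi * t))) \<in> L2"
    by (rule continuous_on_L2)
  fix e :: real assume "e > 0"
  then have "sqrt e / 2 > 0" by simp
  with assms obtain p where p: "real_polynomial_function p"
      "\<And>z. z \<in> sphere 0 1 \<Longrightarrow> \<bar>F z - p z\<bar> < sqrt e / 2"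
    using Stone_Weierstrass_real_polynomial_function[of "sphere 0 1" F "sqrt e / 2"] by auto
  note P = trig_poly_of_polynomial_on_circle[OF p(1)]
  have "l2_inner (\<lambda>t. F (cis (2 * pi * t)) - p (cis (2 * pi * t))) (\<lambda>t. F (cis (2 * pi * t)) - p (cis (2 * pi * t)))
      \<le> (sqrt e / 2)\<^sup>2"
    using p(2) by (intro l2_inner_self_le_bound L2_diff L2 trig_poly_L2[OF P] less_imp_le) auto
  also have "\<dots> < e"
    using \<open>e > 0\<close> by (simp add: power_divide)
  finally show "\<exists>q. trig_poly q \<and>
      l2_inner (\<lambda>t. F (cis (2 * pi * t)) - q t) (\<lambda>t. F (cis (2 * pi * t)) - q t) < e"
    using P by blast
qed

text \<open>The endpoints \<open>0\<close> and \<open>1\<close> are the only two points that wrap to the same point of the circle.\<close>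

lemma cis_two_pi_inj:
  assumes "cis (2 * pi * s) = cis (2 * pi * t)" "s \<in> {0..1}" "0 < t" "t < 1"
  shows "s = t"
proof -
  have "sin (2 * pi * s) = sin (2 * pi * t) \<and> cos (2 * pi * s) = cos (2 * pi * t)"
    using assms(1) by (simp add: complex_eq_iff)
  then obtain n :: int where "2 * pi * s = 2 * pi * t + 2 * pi * of_int n"
    unfolding sin_cos_eq_iff by auto
  then have "2 * pi * s = 2 * pi * (t + of_int n)" by (simp add: distrib_left)
  then have *: "s = t + of_int n" by simp
  with assms have "of_int n < (1::real)" "of_int n > (-1::real)" by auto
  then have "n = 0" by linarith
  with * show ?thesis by simp
qed

lemma AE_unit_leb_interior: "AE t in unit_leb. 0 < t \<and> t < 1"
proof -
  have "AE t in lebesgue. t \<notin> {0, 1::real}"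
    by (intro AE_not_in) (simp add: negligible_iff_null_sets[symmetric])
  then have "AE t in lebesgue. t \<in> {0..1::real} \<longrightarrow> 0 < t \<and> t < 1"
    by eventually_elim auto
  then show ?thesis
    by (subst AE_restrict_space_iff) auto
qed

text \<open>Wrap \<open>K\<close> around the circle. The tent functions \<open>max 0 (1 - k d)\<close>, with \<open>d\<close> the distance to the wrapped
  set, are continuous on the circle and decrease to its indicator, hence to the indicator of \<open>K\<close> away
  from the endpoints.\<close>

lemma trig_approximable_indicator_closed:
  assumes "closed K"
  shows "trig_approximable (indicator K)"
proof (rule trig_approximable_limit)
  \<comment> \<open>The extra point 0 keeps the wrapped set nonempty, as the distance to an empty set would be 0;
      it changes the indicator only at the endpoints.\<close>
  define C where "C = (\<lambda>t. cis (2 * pi * t)) ` insert 0 (K \<inter> {0..1})"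
  define h where "h k t = max 0 (1 - real k * infdist (cis (2 * pi * t)) C)" for k t
  have "compact (insert 0 (K \<inter> {0..1::real}))"
    using assms by (intro compact_insert closed_Int_compact) auto
  then have "compact C"
    unfolding C_def by (intro compact_continuous_image continuous_intros)
  then have C: "closed C" by (rule compact_imp_closed)
  have "C \<noteq> {}" by (simp add: C_def)
  have h: "trig_approximable (h k)" for k
    unfolding h_def
    by (rule trig_approximable_continuous_on_circle) (intro continuous_intros)
  have C_iff: "cis (2 * pi * t) \<in> C \<longleftrightarrow> t \<in> K" if "0 < t" "t < 1" for t
  proof
    assume "cis (2 * pi * t) \<in> C"
    then obtain s where s: "s \<in> insert 0 (K \<inter> {0..1})" "cis (2 * pi * s) = cis (2 * pi * t)"
      unfolding C_def by (elim imageE) (metis that)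
    with cis_two_pi_inj[OF s(2) _ that] have "s = t" by auto
    with s(1) that show "t \<in> K" by auto
  next
    assume "t \<in> K"
    with that show "cis (2 * pi * t) \<in> C"
      unfolding C_def by (intro imageI) auto
  qed
  have lim: "(\<lambda>k. h k t) \<longlonglongrightarrow> indicator K t" if "0 < t" "t < 1" for t
  proof (cases "t \<in> K")
    case True
    with C_iff[OF that] show ?thesis by (simp add: h_def)
  next
    case False
    define d where "d = infdist (cis (2 * pi * t)) C"
    have "d > 0"
      using False C_iff[OF that] C \<open>C \<noteq> {}\<close> unfolding d_def
      by (intro infdist_pos_not_in_closed) auto
    have "eventually (\<lambda>k. h k t = 0) sequentially"
      using eventually_ge_at_top[of "nat \<lceil>1 / d\<rceil>"]
    proof eventually_elim
      case (elim k)
      then have "1 / d \<le> real k" by linarith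
      then have "1 \<le> real k * d" using \<open>d > 0\<close> by (simp add: pos_divide_le_eq)
      then show ?case by (simp add: h_def d_def[symmetric])
    qed
    with False show ?thesis by (simp add: tendsto_eventually)
  qed
  have K: "indicator K \<in> borel_measurable unit_leb"
    using assms by (intro measurable_restrict_space1 borel_measurable_indicator) (simp add: borel_closed)
  have hm: "h k \<in> borel_measurable unit_leb" for k
    using h[of k] by (intro L2_borel_measurable trig_approximable_L2)
  have h01: "0 \<le> h k t" "h k t \<le> 1" for k t
    by (auto simp: h_def infdist_nonneg)
  show "indicator K \<in> L2"
    by (rule L2_bounded[OF K, of 1]) (simp add: indicator_def)
  have "(\<lambda>k. LINT t|unit_leb. (indicator K t - h k t) * (indicator K t - h k t)) \<longlonglongrightarrow> (LINT t|unit_leb. 0)"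
  proof (rule integral_dominated_convergence[where w = "\<lambda>t. 1"])
    show "AE t in unit_leb. (\<lambda>k. (indicator K t - h k t) * (indicator K t - h k t)) \<longlonglongrightarrow> 0"
      using AE_unit_leb_interior
    proof eventually_elim
      case (elim t)
      then have "(\<lambda>k. (indicator K t - h k t) * (indicator K t - h k t))
          \<longlonglongrightarrow> (indicator K t - indicator K t) * (indicator K t - indicator K t)"
        by (intro tendsto_intros lim) auto
      then show ?case by simp
    qed
    show "AE t in unit_leb. norm ((indicator K t - h k t) * (indicator K t - h k t)) \<le> 1" for k
    proof (rule AE_I2)
      fix t
      have "\<bar>indicator K t - h k t\<bar> \<le> 1"
        using h01[of k t] by (auto simp: indicator_def)
      then show "norm ((indicator K t - h k t) * (indicator K t - h k t)) \<le> 1"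
        by (simp add: power2_eq_square[symmetric] abs_square_le_1)
    qed
    show "(\<lambda>t. (indicator K t - h k t) * (indicator K t - h k t)) \<in> borel_measurable unit_leb" for k
      using K hm by (intro borel_measurable_times borel_measurable_diff)
  qed (auto simp: finite_measure.integrable_const finite_measure_unit_leb)
  then have "(\<lambda>k. l2_inner (\<lambda>t. indicator K t - h k t) (\<lambda>t. indicator K t - h k t)) \<longlonglongrightarrow> 0"
    by (simp add: l2_inner_def)
  moreover fix e :: real assume "e > 0"
  ultimately have "eventually (\<lambda>k. l2_inner (\<lambda>t. indicator K t - h k t) (\<lambda>t. indicator K t - h k t) < e) sequentially"
    by (simp add: order_tendsto_iff)
  then show "\<exists>g. trig_approximable g \<and> l2_inner (\<lambda>t. indicator K t - g t) (\<lambda>t. indicator K t - g t) < e"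
    using h by (auto simp: eventually_sequentially)
qed

text \<open>Lebesgue measurable sets are inner regular with respect to closed sets.\<close>

lemma trig_approximable_indicator:
  assumes "S \<in> sets lebesgue"
  shows "trig_approximable (indicator S)"
proof (rule trig_approximable_limit)
  have meas: "A \<inter> {0..1} \<in> sets unit_leb" if "A \<in> sets lebesgue" for A :: "real set"
    using that by (auto simp: sets_restrict_space_iff)
  have "indicator S \<in> borel_measurable unit_leb"
    using assms by (intro measurable_restrict_space1 borel_measurable_indicator)
  then show "indicator S \<in> L2"
    by (rule L2_bounded[of _ 1]) (simp add: indicator_def)
  fix e :: real assume "e > 0"
  obtain T where T: "closed T" "T \<subseteq> S" "S - T \<in> lmeasurable" "emeasure lebesgue (S - T) < ennreal e"
    using sets_lebesgue_inner_closed[OF assms \<open>e > 0\<close>] .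
  have "l2_inner (\<lambda>t. indicator S t - indicator T t) (\<lambda>t. indicator S t - indicator T t)
      = (LINT t|unit_leb. indicator (S - T) t)"
    unfolding l2_inner_def
    using T(2) by (intro Bochner_Integration.integral_cong refl) (auto simp: indicator_def)
  also have "\<dots> = measure unit_leb ((S - T) \<inter> {0..1})"
    using meas[of "S - T"] T(3) by simp
  also have "\<dots> = measure lebesgue ((S - T) \<inter> {0..1})"
    using meas[of "S - T"] T(3) by (simp add: measure_unit_leb fmeasurableD)
  also have "\<dots> \<le> measure lebesgue (S - T)"
    using T(3) by (intro measure_mono_fmeasurable) (auto simp: fmeasurableD)
  also have "\<dots> < e"
    using T(3,4) \<open>e > 0\<close> by (simp add: emeasure_eq_measure2 ennreal_less_iff)
  finally show "\<exists>g. trig_approximable g \<and> l2_inner (\<lambda>t. indicator S t - g t) (\<lambda>t. indicator S t - g t) < e"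
    using trig_approximable_indicator_closed[OF T(1)] by blast
qed

lemma trig_approximable_cong:
  assumes "trig_approximable f" "\<And>t. t \<in> {0..1} \<Longrightarrow> g t = f t"
  shows "trig_approximable g"
proof -
  have "l2_inner (\<lambda>t. g t - p t) (\<lambda>t. g t - p t) = l2_inner (\<lambda>t. f t - p t) (\<lambda>t. f t - p t)" for p
    unfolding l2_inner_def using assms(2) by (intro Bochner_Integration.integral_cong) auto
  moreover have "g \<in> L2"
    using trig_approximable_L2[OF assms(1)] assms(2)
      measurable_cong[of unit_leb g f borel] Bochner_Integration.integrable_cong[of unit_leb unit_leb "\<lambda>t. (g t)\<^sup>2" "\<lambda>t. (f t)\<^sup>2"]
    by (auto simp: L2_def)
  ultimately show ?thesis
    using assms(1) by (simp add: trig_approximable_def)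
qed

text \<open>Simple functions on the interval are finite combinations of indicators.\<close>

lemma trig_approximable_simple_function:
  fixes s :: "real \<Rightarrow> real"
  assumes "simple_function unit_leb s"
  shows "trig_approximable s"
proof (rule trig_approximable_cong)
  have fin: "finite (s ` {0..1})"
    using assms by (simp add: simple_function_def)
  have "s -` {y} \<inter> {0..1} \<in> sets lebesgue" if "y \<in> s ` {0..1}" for y
    using assms that by (auto simp: simple_function_def sets_restrict_space_iff)
  then show "trig_approximable (\<lambda>t. \<Sum>y\<in>s ` {0..1}. y * indicator (s -` {y} \<inter> {0..1}) t)"
    by (intro trig_approximable_sum trig_approximable_scale trig_approximable_indicator)
  fix t :: real assume t: "t \<in> {0..1}"
  have "(\<Sum>y\<in>s ` {0..1}. y * indicator (s -` {y} \<inter> {0..1}) t) = (\<Sum>y\<in>s ` {0..1}. if y = s t then s t else 0)"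
    using t by (intro sum.cong) (auto simp: indicator_def)
  also have "\<dots> = s t"
    using t fin by (simp add: sum.delta)
  finally show "s t = (\<Sum>y\<in>s ` {0..1}. y * indicator (s -` {y} \<inter> {0..1}) t)" ..
qed

text \<open>Simple functions of modulus at most \<open>2 \<bar>f\<bar>\<close> converge to \<open>f\<close> pointwise, hence in \<open>L2\<close> by dominated convergence with
  the bound \<open>(3 \<bar>f\<bar>)\<^sup>2\<close>.\<close>

theorem trig_poly_dense:
  assumes "f \<in> L2"
  shows "trig_approximable f"
proof (rule trig_approximable_limit[OF assms])
  note fm = L2_borel_measurable[OF assms]
  obtain s where "\<forall>i. simple_function unit_leb (s i)"
      "\<forall>t\<in>{0..1}. (\<lambda>i. s i t) \<longlonglongrightarrow> f t" "\<forall>i. \<forall>t\<in>{0..1}. \<bar>s i t\<bar> \<le> 2 * \<bar>f t\<bar>"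
    using borel_measurable_implies_sequence_metric[OF fm, of 0] by (auto simp: dist_real_def)
  then have s: "\<And>i. simple_function unit_leb (s i)"
      "\<And>t. t \<in> {0..1} \<Longrightarrow> (\<lambda>i. s i t) \<longlonglongrightarrow> f t"
      "\<And>i t. t \<in> {0..1} \<Longrightarrow> \<bar>s i t\<bar> \<le> 2 * \<bar>f t\<bar>"
    by blast+
  have sm: "s i \<in> borel_measurable unit_leb" for i
    by (rule borel_measurable_simple_function[OF s(1)])
  have "(\<lambda>i. LINT t|unit_leb. (f t - s i t) * (f t - s i t)) \<longlonglongrightarrow> (LINT t|unit_leb. 0)"
  proof (rule integral_dominated_convergence[where w = "\<lambda>t. 9 * (f t)\<^sup>2"])
    show "AE t in unit_leb. (\<lambda>i. (f t - s i t) * (f t - s i t)) \<longlonglongrightarrow> 0"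
    proof (rule AE_I2)
      fix t assume "t \<in> space unit_leb"
      then have "(\<lambda>i. (f t - s i t) * (f t - s i t)) \<longlonglongrightarrow> (f t - f t) * (f t - f t)"
        by (intro tendsto_intros s) auto
      then show "(\<lambda>i. (f t - s i t) * (f t - s i t)) \<longlonglongrightarrow> 0" by simp
    qed
    show "AE t in unit_leb. norm ((f t - s i t) * (f t - s i t)) \<le> 9 * (f t)\<^sup>2" for i
    proof (rule AE_I2)
      fix t assume "t \<in> space unit_leb"
      then have "\<bar>f t - s i t\<bar> \<le> 3 * \<bar>f t\<bar>"
        using s(3)[of t i] by auto
      then have "\<bar>f t - s i t\<bar>\<^sup>2 \<le> (3 * \<bar>f t\<bar>)\<^sup>2"
        by (intro power_mono) auto
      then show "norm ((f t - s i t) * (f t - s i t)) \<le> 9 * (f t)\<^sup>2"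
        by (simp add: power_mult_distrib abs_mult power2_eq_square)
    qed
  qed (use fm sm L2_square_integrable[OF assms] in auto)
  then have "(\<lambda>i. l2_inner (\<lambda>t. f t - s i t) (\<lambda>t. f t - s i t)) \<longlonglongrightarrow> 0"
    by (simp add: l2_inner_def)
  moreover fix e :: real assume "e > 0"
  ultimately have "eventually (\<lambda>i. l2_inner (\<lambda>t. f t - s i t) (\<lambda>t. f t - s i t) < e) sequentially"
    by (simp add: order_tendsto_iff)
  then show "\<exists>g. trig_approximable g \<and> l2_inner (\<lambda>t. f t - g t) (\<lambda>t. f t - g t) < e"
    using trig_approximable_simple_function[OF s(1)] by (auto simp: eventually_sequentially)
qed

text \<open>A trigonometric polynomial at squared distance below \<open>e\<close> from \<open>f\<close> is a combination of the first \<open>n\<close> basis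
  functions for all large \<open>n\<close>, and the \<open>n\<close>-th Fourier partial sum is at least as close.\<close>

theorem Parseval:
  assumes "f \<in> L2"
  shows "(\<lambda>j. (l2_inner f (psi (Suc j)))\<^sup>2) sums l2_inner f f"
proof -
  define b where "b n = (\<Sum>j=1..n. (l2_inner f (psi j))\<^sup>2)" for n
  have "b \<longlonglongrightarrow> l2_inner f f"
  proof (rule LIMSEQ_I)
    fix e :: real assume "e > 0"
    then obtain p where p: "trig_poly p" "l2_inner (\<lambda>t. f t - p t) (\<lambda>t. f t - p t) < e"
      using trig_poly_dense[OF assms] by (auto simp: trig_approximable_def)
    from trig_poly_psi_combination[OF p(1)] obtain a N
      where a: "\<And>n t. n \<ge> N \<Longrightarrow> p t = (\<Sum>j=1..n. a j * psi j t)" by blast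
    have "norm (b n - l2_inner f f) < e" if "n \<ge> N" for n
    proof -
      have "p = (\<lambda>t. \<Sum>j=1..n. a j * psi j t)"
        using a[OF that] by blast
      then have "l2_inner f f - b n \<le> l2_inner (\<lambda>t. f t - p t) (\<lambda>t. f t - p t)"
        unfolding b_def using l2_distance_psi_combination[OF assms, of a n]
        by (simp add: sum_nonneg)
      with p(2) Bessel_inequality[OF assms, of n] show ?thesis
        by (simp add: b_def)
    qed
    then show "\<exists>N. \<forall>n\<ge>N. norm (b n - l2_inner f f) < e" by blast
  qed
  moreover have "(\<Sum>j<n. (l2_inner f (psi (Suc j)))\<^sup>2) = b n" for n
    unfolding b_def by (rule sum.reindex_bij_witness[of _ "\<lambda>j. j - 1" Suc]) auto
  ultimately show ?thesis
    by (simp add: sums_def)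
qed

section \<open>Random functions diagonal in the trigonometric basis\<close>

lemma space_L2_borel: "space L2_borel = L2"
  unfolding L2_borel_def by (intro space_measure_of) auto

text \<open>By the Cauchy-Schwarz inequality the functional is Lipschitz continuous, so preimages of open sets are among the
  generators of \<open>L2_borel\<close>. The constant \<open>l2_norm f + 1\<close> avoids dividing by zero when \<open>f\<close> is null.\<close>

lemma measurable_l2_inner:
  assumes "f \<in> L2"
  shows "(\<lambda>g. l2_inner g f) \<in> borel_measurable L2_borel"
proof (rule borel_measurableI)
  fix S :: "real set" assume "open S"
  define U where "U = {g \<in> L2. l2_inner g f \<in> S}"
  have "\<exists>e>0. \<forall>g'\<in>L2. l2_norm (\<lambda>t. g' t - g t) < e \<longrightarrow> g' \<in> U" if g: "g \<in> U" for g
  proof -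
    from g have "g \<in> L2" "l2_inner g f \<in> S" by (auto simp: U_def)
    with \<open>open S\<close> obtain d where d: "d > 0" "\<And>y. dist y (l2_inner g f) < d \<Longrightarrow> y \<in> S"
      by (auto simp: open_dist)
    define e where "e = d / (l2_norm f + 1)"
    have pos: "l2_norm f + 1 > 0" using l2_norm_nonneg[of f] by simp
    have "g' \<in> U" if g': "g' \<in> L2" "l2_norm (\<lambda>t. g' t - g t) < e" for g'
    proof -
      have "\<bar>l2_inner g' f - l2_inner g f\<bar> \<le> l2_norm (\<lambda>t. g' t - g t) * l2_norm f"
        using l2_Cauchy_Schwarz[OF L2_diff[OF g'(1) \<open>g \<in> L2\<close>] assms] g' \<open>g \<in> L2\<close> assms
        by (simp add: l2_inner_diff)
      also have "\<dots> \<le> l2_norm (\<lambda>t. g' t - g t) * (l2_norm f + 1)"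
        by (intro mult_left_mono l2_norm_nonneg) simp
      also have "\<dots> < d"
        using g'(2) pos by (simp add: e_def pos_less_divide_eq)
      finally show ?thesis
        using d(2) g'(1) by (simp add: U_def dist_real_def)
    qed
    moreover have "e > 0" using d(1) pos by (simp add: e_def)
    ultimately show ?thesis by blast
  qed
  then have "U \<in> sets L2_borel"
    unfolding L2_borel_def by (subst sets_measure_of) (auto simp: U_def)
  moreover have "(\<lambda>g. l2_inner g f) -` S \<inter> space L2_borel = U"
    by (auto simp: U_def space_L2_borel)
  ultimately show "(\<lambda>g. l2_inner g f) -` S \<inter> space L2_borel \<in> sets L2_borel"
    by simp
qed

text \<open>Parseval's identity exhibits the squared norm as a limit of finite sums of squared functionals.\<close>

lemma measurable_l2_inner_self: "(\<lambda>g. l2_inner g g) \<in> borel_measurable L2_borel"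
proof (rule borel_measurable_LIMSEQ_real)
  fix g assume "g \<in> space L2_borel"
  then show "(\<lambda>n. \<Sum>j<n. (l2_inner g (psi (Suc j)))\<^sup>2) \<longlonglongrightarrow> l2_inner g g"
    using Parseval[of g] by (simp add: space_L2_borel sums_def)
next
  show "(\<lambda>g. \<Sum>j<n. (l2_inner g (psi (Suc j)))\<^sup>2) \<in> borel_measurable L2_borel" for n
    by (intro borel_measurable_sum borel_measurable_power measurable_l2_inner psi_in_L2)
qed

locale trig_diagonal_function = prob_space M for M :: "'a measure" +
  fixes X :: "'a \<Rightarrow> real \<Rightarrow> real" and \<eta> :: real
  assumes moment_class: "X \<in> X_moment_class M 4 \<eta>"
    and diagonal: "diagonal_in_trig_basis M X"
    and moment_bound_nonneg: "\<eta> \<ge> 0"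
begin

abbreviation \<Lambda> :: "nat \<Rightarrow> real" where "\<Lambda> \<equiv> eigval M X"

abbreviation \<xi> :: "nat \<Rightarrow> 'a \<Rightarrow> real" where "\<xi> j x \<equiv> l2_inner (X x) (psi j)"

abbreviation sqnorm :: "'a \<Rightarrow> real" where "sqnorm x \<equiv> l2_inner (X x) (X x)"

lemma X_measurable [measurable]: "X \<in> measurable M L2_borel"
  and X_jointly_measurable [measurable]:
    "(\<lambda>(x, t). X x t) \<in> borel_measurable (M \<Otimes>\<^sub>M unit_leb)"
  and X_centered: "f \<in> L2 \<Longrightarrow> (\<integral>x. l2_inner (X x) f \<partial>M) = 0"
  and X_square_integrable: "t \<in> {0..1} \<Longrightarrow> integrable M (\<lambda>x. (X x t)\<^sup>2)"
  and X_norm_finite: "(\<integral>\<^sup>+x. ennreal ((l2_norm (X x))\<^sup>2) \<partial>M) < \<infinity>"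
  and \<xi>_moment: "j \<ge> 1 \<Longrightarrow> (\<integral>\<^sup>+x. ennreal (\<bar>\<xi> j x / sqrt (\<Lambda> j)\<bar> ^ 4) \<partial>M) \<le> ennreal \<eta>"
  using moment_class
  by (auto simp: X_moment_class_def X_class_def random_function_def centered_function_def
      second_order_stationary_def SUP_le_iff)

lemma eigval_pos: "j \<ge> 1 \<Longrightarrow> \<Lambda> j > 0"
  and eigenfunction: "j \<ge> 1 \<Longrightarrow> AE s in unit_leb. cov_op M X (psi j) s = \<Lambda> j * psi j s"
  using diagonal by (auto simp: diagonal_in_trig_basis_def)

lemma X_in_L2: "x \<in> space M \<Longrightarrow> X x \<in> L2"
  using measurable_space[OF X_measurable] by (simp add: space_L2_borel)

lemma inner_X_measurable: "f \<in> L2 \<Longrightarrow> (\<lambda>x. l2_inner (X x) f) \<in> borel_measurable M"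
  using measurable_compose[OF X_measurable measurable_l2_inner] .

lemma \<xi>_measurable [measurable]: "\<xi> j \<in> borel_measurable M"
  by (rule inner_X_measurable[OF psi_in_L2])

lemma sqnorm_measurable [measurable]: "sqnorm \<in> borel_measurable M"
  using measurable_compose[OF X_measurable measurable_l2_inner_self] .

lemma sqnorm_integrable: "integrable M sqnorm"
proof (rule integrableI_nonneg)
  show "(\<integral>\<^sup>+x. ennreal (sqnorm x) \<partial>M) < \<infinity>"
    using X_norm_finite by (simp add: l2_norm_square)
qed (auto simp: l2_inner_self_nonneg)

lemma \<xi>_fourth_integrable:
  assumes "j \<ge> 1"
  shows "integrable M (\<lambda>x. (\<xi> j x) ^ 4)" and "(\<integral>x. (\<xi> j x) ^ 4 \<partial>M) \<le> \<eta> * (\<Lambda> j)\<^sup>2"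
proof -
  have pos: "\<Lambda> j > 0" using eigval_pos[OF assms] .
  have sq: "sqrt (\<Lambda> j) ^ 4 = (\<Lambda> j)\<^sup>2"
  proof -
    have "sqrt (\<Lambda> j) ^ 4 = (sqrt (\<Lambda> j) ^ 2) ^ 2" by (simp add: power_mult[symmetric])
    with pos show ?thesis by simp
  qed
  have eq: "\<bar>\<xi> j x / sqrt (\<Lambda> j)\<bar> ^ 4 = (\<xi> j x) ^ 4 / (\<Lambda> j)\<^sup>2" for x
    by (simp add: power_even_abs power_divide sq)
  note mom = \<xi>_moment[OF assms, unfolded eq]
  have int: "integrable M (\<lambda>x. (\<xi> j x) ^ 4 / (\<Lambda> j)\<^sup>2)"
  proof (rule integrableI_nonneg)
    show "(\<integral>\<^sup>+x. ennreal ((\<xi> j x) ^ 4 / (\<Lambda> j)\<^sup>2) \<partial>M) < \<infinity>"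
      using mom by (rule le_less_trans) simp
  qed auto
  then have "integrable M (\<lambda>x. (\<Lambda> j)\<^sup>2 * ((\<xi> j x) ^ 4 / (\<Lambda> j)\<^sup>2))"
    by (rule integrable_mult_right)
  with pos show *: "integrable M (\<lambda>x. (\<xi> j x) ^ 4)" by simp
  have "ennreal (\<integral>x. (\<xi> j x) ^ 4 / (\<Lambda> j)\<^sup>2 \<partial>M) \<le> ennreal \<eta>"
    using mom int by (simp add: nn_integral_eq_integral)
  then have "(\<integral>x. (\<xi> j x) ^ 4 / (\<Lambda> j)\<^sup>2 \<partial>M) \<le> \<eta>"
    using moment_bound_nonneg by simp
  with pos show "(\<integral>x. (\<xi> j x) ^ 4 \<partial>M) \<le> \<eta> * (\<Lambda> j)\<^sup>2"
    by (simp add: pos_divide_le_eq)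
qed

lemma \<xi>_square_integrable: "integrable M (\<lambda>x. (\<xi> j x)\<^sup>2)"
proof (rule Bochner_Integration.integrable_bound)
  show "integrable M (\<lambda>x. (l2_norm (psi j))\<^sup>2 * sqnorm x)"
    by (intro integrable_mult_right sqnorm_integrable)
  show "AE x in M. norm ((\<xi> j x)\<^sup>2) \<le> norm ((l2_norm (psi j))\<^sup>2 * sqnorm x)"
  proof (rule AE_I2)
    fix x assume "x \<in> space M"
    then have "\<bar>\<xi> j x\<bar>\<^sup>2 \<le> (l2_norm (X x) * l2_norm (psi j))\<^sup>2"
      by (intro power_mono l2_Cauchy_Schwarz X_in_L2 psi_in_L2) auto
    then show "norm ((\<xi> j x)\<^sup>2) \<le> norm ((l2_norm (psi j))\<^sup>2 * sqnorm x)"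
      by (simp add: power_mult_distrib l2_norm_square l2_inner_self_nonneg mult.commute)
  qed
qed measurable

lemma sum_eigval_le: "(\<Sum>j=1..n. \<Lambda> j) \<le> (\<integral>x. sqnorm x \<partial>M)"
proof -
  have "(\<Sum>j=1..n. \<Lambda> j) = (\<integral>x. (\<Sum>j=1..n. (\<xi> j x)\<^sup>2) \<partial>M)"
    unfolding eigval_def by (intro Bochner_Integration.integral_sum[symmetric] \<xi>_square_integrable)
  also have "\<dots> \<le> (\<integral>x. sqnorm x \<partial>M)"
    by (intro integral_mono sqnorm_integrable Bochner_Integration.integrable_sum \<xi>_square_integrable
        Bessel_inequality X_in_L2)
  finally show ?thesis .
qed

text \<open>The weights \<open>sqrt \<lambda>\<^sub>j\<close> in the Cauchy-Schwarz inequality are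
  chosen so that \<open>E \<xi>\<^sub>j\<^sup>4 / \<lambda>\<^sub>j \<le> \<eta> \<lambda>\<^sub>j\<close> has a convergent sum over \<open>j\<close>; Fatou's lemma passes from partial sums to the norm.\<close>

lemma sqnorm_square_integrable: "integrable M (\<lambda>x. (sqnorm x)\<^sup>2)"
proof (rule integrableI_nonneg)
  show "(\<lambda>x. (sqnorm x)\<^sup>2) \<in> borel_measurable M" by measurable
  define \<tau> where "\<tau> = (\<integral>x. sqnorm x \<partial>M)"
  have "\<tau> \<ge> 0" unfolding \<tau>_def by (intro integral_nonneg_AE) (auto simp: l2_inner_self_nonneg)
  define S where "S n x = (\<Sum>j=1..n. (\<xi> j x)\<^sup>2)" for n x
  have S_meas [measurable]: "S n \<in> borel_measurable M" for n
    unfolding S_def by measurable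
  have nz: "\<Lambda> j \<noteq> 0" if "j \<ge> 1" for j
    using eigval_pos[OF that] by simp
  have bound: "(\<integral>\<^sup>+x. ennreal ((S n x)\<^sup>2) \<partial>M) \<le> ennreal (\<eta> * \<tau>\<^sup>2)" for n
  proof -
    have int: "integrable M (\<lambda>x. \<tau> * (\<Sum>j=1..n. (\<xi> j x) ^ 4 / \<Lambda> j))"
      by (intro integrable_mult_right Bochner_Integration.integrable_sum integrable_divide_zero
          \<xi>_fourth_integrable(1)) auto
    have "(S n x)\<^sup>2 \<le> \<tau> * (\<Sum>j=1..n. (\<xi> j x) ^ 4 / \<Lambda> j)" for x
    proof -
      have "(S n x)\<^sup>2 = (\<Sum>j=1..n. sqrt (\<Lambda> j) * ((\<xi> j x)\<^sup>2 / sqrt (\<Lambda> j)))\<^sup>2"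
        unfolding S_def using nz by (intro arg_cong[of _ _ "\<lambda>s. s\<^sup>2"] sum.cong) auto
      also have "\<dots> \<le> (\<Sum>j=1..n. (sqrt (\<Lambda> j))\<^sup>2) * (\<Sum>j=1..n. ((\<xi> j x)\<^sup>2 / sqrt (\<Lambda> j))\<^sup>2)"
        by (rule Cauchy_Schwarz_ineq_sum)
      also have "(\<Sum>j=1..n. ((\<xi> j x)\<^sup>2 / sqrt (\<Lambda> j))\<^sup>2) = (\<Sum>j=1..n. (\<xi> j x) ^ 4 / \<Lambda> j)"
        using eigval_pos by (intro sum.cong refl) (simp add: power_divide power_mult[symmetric] less_imp_le)
      also have "(\<Sum>j=1..n. (sqrt (\<Lambda> j))\<^sup>2) = (\<Sum>j=1..n. \<Lambda> j)"
        using eigval_pos by (intro sum.cong refl) (simp add: less_imp_le)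
      also have "(\<Sum>j=1..n. \<Lambda> j) * (\<Sum>j=1..n. (\<xi> j x) ^ 4 / \<Lambda> j) \<le> \<tau> * (\<Sum>j=1..n. (\<xi> j x) ^ 4 / \<Lambda> j)"
        using eigval_pos sum_eigval_le[of n] unfolding \<tau>_def
        by (intro mult_right_mono sum_nonneg divide_nonneg_nonneg) (auto simp: less_imp_le)
      finally show ?thesis .
    qed
    then have "(\<integral>\<^sup>+x. ennreal ((S n x)\<^sup>2) \<partial>M) \<le> (\<integral>\<^sup>+x. ennreal (\<tau> * (\<Sum>j=1..n. (\<xi> j x) ^ 4 / \<Lambda> j)) \<partial>M)"
      by (intro nn_integral_mono ennreal_leI)
    also have "\<dots> = ennreal (\<integral>x. \<tau> * (\<Sum>j=1..n. (\<xi> j x) ^ 4 / \<Lambda> j) \<partial>M)"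
      using int \<open>\<tau> \<ge> 0\<close> eigval_pos
      by (intro nn_integral_eq_integral AE_I2 mult_nonneg_nonneg sum_nonneg divide_nonneg_nonneg)
        (auto simp: less_imp_le)
    also have "(\<integral>x. \<tau> * (\<Sum>j=1..n. (\<xi> j x) ^ 4 / \<Lambda> j) \<partial>M) = \<tau> * (\<Sum>j=1..n. (\<integral>x. (\<xi> j x) ^ 4 \<partial>M) / \<Lambda> j)"
      using \<xi>_fourth_integrable(1) by (simp add: Bochner_Integration.integral_sum)
    also have "\<dots> \<le> \<tau> * (\<Sum>j=1..n. \<eta> * \<Lambda> j)"
      using \<open>\<tau> \<ge> 0\<close> \<xi>_fourth_integrable(2) eigval_pos
      by (intro mult_left_mono sum_mono) (auto simp: pos_divide_le_eq power2_eq_square mult.assoc)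
    also have "\<dots> \<le> \<tau> * (\<eta> * \<tau>)"
      using \<open>\<tau> \<ge> 0\<close> moment_bound_nonneg sum_eigval_le[of n] unfolding sum_distrib_left[symmetric] \<tau>_def
      by (intro mult_left_mono) auto
    finally show ?thesis
      by (simp add: power2_eq_square mult_ac ennreal_leI)
  qed
  have "ennreal ((sqnorm x)\<^sup>2) = liminf (\<lambda>n. ennreal ((S n x)\<^sup>2))" if "x \<in> space M" for x
  proof -
    have "(\<Sum>j<n. (l2_inner (X x) (psi (Suc j)))\<^sup>2) = S n x" for n
      unfolding S_def by (rule sum.reindex_bij_witness[of _ "\<lambda>j. j - 1" Suc]) auto
    then have "(\<lambda>n. S n x) \<longlonglongrightarrow> sqnorm x"
      using Parseval[OF X_in_L2[OF that]] by (simp add: sums_def)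
    then have "(\<lambda>n. ennreal ((S n x)\<^sup>2)) \<longlonglongrightarrow> ennreal ((sqnorm x)\<^sup>2)"
      by (intro tendsto_ennrealI tendsto_power)
    then show ?thesis
      by (intro lim_imp_Liminf[symmetric]) auto
  qed
  then have "(\<integral>\<^sup>+x. ennreal ((sqnorm x)\<^sup>2) \<partial>M) = (\<integral>\<^sup>+x. liminf (\<lambda>n. ennreal ((S n x)\<^sup>2)) \<partial>M)"
    by (intro nn_integral_cong)
  also have "\<dots> \<le> liminf (\<lambda>n. \<integral>\<^sup>+x. ennreal ((S n x)\<^sup>2) \<partial>M)"
    by (intro nn_integral_liminf) measurable
  also have "\<dots> \<le> liminf (\<lambda>n. ennreal (\<eta> * \<tau>\<^sup>2))"
    by (intro Liminf_mono always_eventually allI bound)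
  also have "\<dots> < \<infinity>"
    by (simp add: Liminf_const)
  finally show "(\<integral>\<^sup>+x. ennreal ((sqnorm x)\<^sup>2) \<partial>M) < \<infinity>" .
qed auto

text \<open>The integral over the sample space and the inner product with \<open>f\<close> may be interchanged, also after weighting
  with a random variable \<open>W\<close>: the weights \<open>1\<close>, \<open>X s\<close> and \<open>\<xi>\<^sub>j\<close> are what the analysis of the covariance
  operator requires.\<close>

lemma Fubini_inner:
  assumes [measurable]: "W \<in> borel_measurable M"
    and W: "integrable M (\<lambda>x. \<bar>W x\<bar> * l2_norm (X x))" and f: "f \<in> L2"
  shows "integrable unit_leb (\<lambda>t. (\<integral>x. W x * X x t \<partial>M) * f t)"
    and "(LINT t|unit_leb. (\<integral>x. W x * X x t \<partial>M) * f t) = (\<integral>x. W x * l2_inner (X x) f \<partial>M)"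
proof -
  interpret L: finite_measure unit_leb by (rule finite_measure_unit_leb)
  interpret pair_sigma_finite M unit_leb ..
  note [measurable] = L2_borel_measurable[OF f]
  define F where "F x t = W x * X x t * f t" for x t
  have F_meas [measurable]: "case_prod F \<in> borel_measurable (M \<Otimes>\<^sub>M unit_leb)"
    unfolding F_def by measurable
  have abs_L2: "(\<lambda>t. \<bar>g t\<bar>) \<in> L2" if "g \<in> L2" for g
    using that by (auto simp: L2_def)
  have norm_abs: "l2_norm (\<lambda>t. \<bar>g t\<bar>) = l2_norm g" for g
    by (simp add: l2_norm_def l2_inner_def)
  have F_int: "integrable unit_leb (F x)" if "x \<in> space M" for x
    unfolding F_def mult.assoc using that f by (intro integrable_mult_right L2_mult_integrable X_in_L2)
  have "integrable M (\<lambda>x. LINT t|unit_leb. norm (F x t))"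
  proof (rule Bochner_Integration.integrable_bound)
    show "integrable M (\<lambda>x. l2_norm f * (\<bar>W x\<bar> * l2_norm (X x)))"
      by (rule integrable_mult_right[OF W])
    show "AE x in M. norm (LINT t|unit_leb. norm (F x t)) \<le> norm (l2_norm f * (\<bar>W x\<bar> * l2_norm (X x)))"
    proof (rule AE_I2)
      fix x assume x: "x \<in> space M"
      have "(LINT t|unit_leb. norm (F x t)) = \<bar>W x\<bar> * l2_inner (\<lambda>t. \<bar>X x t\<bar>) (\<lambda>t. \<bar>f t\<bar>)"
        by (simp add: F_def l2_inner_def abs_mult mult.assoc)
      also have "\<dots> \<le> \<bar>W x\<bar> * (l2_norm (X x) * l2_norm f)"
        using l2_Cauchy_Schwarz[OF abs_L2[OF X_in_L2[OF x]] abs_L2[OF f]]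
        by (intro mult_left_mono) (auto simp: norm_abs)
      finally show "norm (LINT t|unit_leb. norm (F x t)) \<le> norm (l2_norm f * (\<bar>W x\<bar> * l2_norm (X x)))"
        by (simp add: abs_mult l2_norm_nonneg mult_ac)
    qed
  qed measurable
  then have int: "integrable (M \<Otimes>\<^sub>M unit_leb) (case_prod F)"
    using F_int by (intro Fubini_integrable) auto
  have eq: "(\<integral>x. F x t \<partial>M) = (\<integral>x. W x * X x t \<partial>M) * f t" for t
    by (simp add: F_def)
  show "integrable unit_leb (\<lambda>t. (\<integral>x. W x * X x t \<partial>M) * f t)"
    using integrable_snd[OF int] by (simp add: eq)
  have "(LINT t|unit_leb. (\<integral>x. F x t \<partial>M)) = (\<integral>x. (LINT t|unit_leb. F x t) \<partial>M)"
    by (rule Fubini_integral[OF int])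
  also have "\<dots> = (\<integral>x. W x * l2_inner (X x) f \<partial>M)"
    by (simp add: F_def l2_inner_def mult.assoc)
  finally show "(LINT t|unit_leb. (\<integral>x. W x * X x t \<partial>M) * f t) = (\<integral>x. W x * l2_inner (X x) f \<partial>M)"
    by (simp add: eq)
qed

lemma norm_X_measurable [measurable]: "(\<lambda>x. l2_norm (X x)) \<in> borel_measurable M"
  unfolding l2_norm_def by measurable

lemma integrable_mult_norm_X:
  assumes [measurable]: "W \<in> borel_measurable M" and "integrable M (\<lambda>x. (W x)\<^sup>2)"
  shows "integrable M (\<lambda>x. \<bar>W x\<bar> * l2_norm (X x))"
  using assms(2) sqnorm_integrable
  by (intro integrable_mult_of_squares) (simp_all add: l2_norm_square)

lemma X_at_measurable: "t \<in> {0..1} \<Longrightarrow> (\<lambda>x. X x t) \<in> borel_measurable M"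
  using measurable_compose[OF measurable_Pair2' X_jointly_measurable] by simp

lemma X_at_integrable: "t \<in> {0..1} \<Longrightarrow> integrable M (\<lambda>x. X x t)"
  by (rule square_integrable_imp_integrable[OF X_at_measurable X_square_integrable])

text \<open>The functions \<open>X\<close> are centered only as random elements of \<open>L2\<close>, so the pointwise means \<open>\<mu> t\<close> may differ from
  zero on a null set. They drop out after integration against \<open>f\<close>.\<close>

lemma cov_op_eq:
  assumes f: "f \<in> L2" and s: "s \<in> {0..1}"
  shows "cov_op M X f s = (\<integral>x. l2_inner (X x) f * X x s \<partial>M)"
proof -
  define \<mu> where "\<mu> t = (\<integral>x. X x t \<partial>M)" for t
  have cov: "Cov M (\<lambda>x. X x t) (\<lambda>x. X x s) = (\<integral>x. X x s * X x t \<partial>M) - \<mu> s * \<mu> t" if t: "t \<in> {0..1}" for t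
  proof -
    have prod: "integrable M (\<lambda>x. X x s * X x t)"
      using s t by (intro integrable_mult_of_squares X_at_measurable X_square_integrable)
    have "Cov M (\<lambda>x. X x t) (\<lambda>x. X x s)
        = (\<integral>x. X x s * X x t - \<mu> s * X x t - \<mu> t * X x s + \<mu> s * \<mu> t \<partial>M)"
      unfolding Cov_def \<mu>_def[symmetric] by (simp add: algebra_simps)
    also have "\<dots> = (\<integral>x. X x s * X x t \<partial>M) - \<mu> s * \<mu> t - \<mu> t * \<mu> s + \<mu> s * \<mu> t"
      using prod X_at_integrable[OF s] X_at_integrable[OF t]
      by (simp add: \<mu>_def prob_space)
    finally show ?thesis by simp
  qed
  have one: "integrable M (\<lambda>x. \<bar>1\<bar> * l2_norm (X x))"
    by (rule integrable_mult_norm_X) auto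
  have Xs: "integrable M (\<lambda>x. \<bar>X x s\<bar> * l2_norm (X x))"
    using s by (intro integrable_mult_norm_X X_at_measurable X_square_integrable)
  note F1 = Fubini_inner[OF _ one f, simplified]
  note F2 = Fubini_inner[OF X_at_measurable[OF s] Xs f]
  have "cov_op M X f s = (LINT t|unit_leb. ((\<integral>x. X x s * X x t \<partial>M) - \<mu> s * \<mu> t) * f t)"
    unfolding cov_op_def using cov by (intro Bochner_Integration.integral_cong refl) simp
  also have "\<dots> = (LINT t|unit_leb. (\<integral>x. X x s * X x t \<partial>M) * f t - \<mu> s * (\<mu> t * f t))"
    by (simp add: left_diff_distrib mult.assoc)
  also have "\<dots> = (\<integral>x. X x s * l2_inner (X x) f \<partial>M) - \<mu> s * (\<integral>x. l2_inner (X x) f \<partial>M)"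
    using F1 F2 by (simp add: \<mu>_def)
  finally show ?thesis
    using X_centered[OF f] by (simp add: mult.commute)
qed

text \<open>The left-hand side is the inner product of \<open>f\<close> with the image of \<open>psi j\<close> under the covariance operator,
  by Fubini's theorem, and \<open>psi j\<close> is an eigenfunction. Taking \<open>f = \<beta>\<close> identifies the slope without
  expanding \<open>\<beta>\<close> in the basis.\<close>

lemma expectation_\<xi>_inner:
  assumes j: "j \<ge> 1" and f: "f \<in> L2"
  shows "(\<integral>x. \<xi> j x * l2_inner (X x) f \<partial>M) = \<Lambda> j * l2_inner f (psi j)"
proof -
  have \<xi>: "\<xi> j \<in> borel_measurable M"
    by (rule inner_X_measurable[OF psi_in_L2])
  note F = Fubini_inner[OF \<xi> integrable_mult_norm_X[OF \<xi> \<xi>_square_integrable] f]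
  have "(\<integral>x. \<xi> j x * l2_inner (X x) f \<partial>M) = (LINT s|unit_leb. (\<integral>x. \<xi> j x * X x s \<partial>M) * f s)"
    using F(2) by simp
  also have "\<dots> = (LINT s|unit_leb. \<Lambda> j * (f s * psi j s))"
  proof (rule integral_cong_AE)
    show "AE s in unit_leb. (\<integral>x. \<xi> j x * X x s \<partial>M) * f s = \<Lambda> j * (f s * psi j s)"
      using eigenfunction[OF j] AE_space
    proof eventually_elim
      case (elim s)
      then show ?case
        using cov_op_eq[OF psi_in_L2, of s j] by simp
    qed
    show "(\<lambda>s. \<Lambda> j * (f s * psi j s)) \<in> borel_measurable unit_leb"
      using f psi_in_L2 by (intro borel_measurable_times borel_measurable_const L2_borel_measurable)
  qed (use F(1) in auto)
  also have "\<dots> = \<Lambda> j * l2_inner f (psi j)"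
    by (simp add: l2_inner_def)
  finally show ?thesis .
qed

end

section \<open>Averages over an independent sample\<close>

text \<open>The mixed terms vanish: a summand is centered and independent of the sum of the others.\<close>

lemma (in prob_space) second_moment_sum_indep:
  fixes Z :: "'i \<Rightarrow> 'a \<Rightarrow> real"
  assumes "finite I" "indep_vars (\<lambda>_. borel) Z I"
    and "\<And>i. i \<in> I \<Longrightarrow> integrable M (\<lambda>x. (Z i x)\<^sup>2)" "\<And>i. i \<in> I \<Longrightarrow> expectation (Z i) = 0"
  shows "integrable M (\<lambda>x. (\<Sum>i\<in>I. Z i x)\<^sup>2)
    \<and> expectation (\<lambda>x. (\<Sum>i\<in>I. Z i x)\<^sup>2) = (\<Sum>i\<in>I. expectation (\<lambda>x. (Z i x)\<^sup>2))"
  using assms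
proof (induction I rule: finite_induct)
  case (insert i F)
  define S where "S x = (\<Sum>j\<in>F. Z j x)" for x
  have rv: "Z j \<in> borel_measurable M" if "j \<in> insert i F" for j
    using insert.prems(1) that by (auto simp: indep_vars_def)
  have int: "integrable M (Z j)" if "j \<in> insert i F" for j
    using rv[OF that] insert.prems(2)[OF that] by (rule square_integrable_imp_integrable)
  have IH: "integrable M (\<lambda>x. (S x)\<^sup>2)" "expectation (\<lambda>x. (S x)\<^sup>2) = (\<Sum>i\<in>F. expectation (\<lambda>x. (Z i x)\<^sup>2))"
    using insert.IH insert.prems indep_vars_subset[OF insert.prems(1)] unfolding S_def by auto
  have intS: "integrable M S"
    unfolding S_def using int by (intro Bochner_Integration.integrable_sum) auto
  have S0: "expectation S = 0"
    unfolding S_def using int insert.prems(3) by (subst Bochner_Integration.integral_sum) auto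
  have ind: "indep_var borel (Z i) borel S"
    using indep_vars_sum[OF insert.hyps insert.prems(1)] unfolding S_def .
  have prod: "integrable M (\<lambda>x. Z i x * S x)" "expectation (\<lambda>x. Z i x * S x) = 0"
    using indep_var_integrable[OF ind] indep_var_lebesgue_integral[OF ind] int intS S0 by auto
  have eq: "(\<Sum>j\<in>insert i F. Z j x)\<^sup>2 = (Z i x)\<^sup>2 + (S x)\<^sup>2 + 2 * (Z i x * S x)" for x
    using insert.hyps by (simp add: S_def power2_sum)
  show ?case
    unfolding eq using insert.hyps insert.prems(2)[of i] IH prod by simp
qed simp

lemma iid_sampleD:
  assumes "iid_sample P n Ys Xs M Y X"
  shows "prob_space P"
    and "prob_space.indep_vars P (\<lambda>_. borel \<Otimes>\<^sub>M L2_borel) (\<lambda>i x. (Ys i x, Xs i x)) {1..n}"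
    and "i \<in> {1..n} \<Longrightarrow> distr P (borel \<Otimes>\<^sub>M L2_borel) (\<lambda>x. (Ys i x, Xs i x)) =
                 distr M (borel \<Otimes>\<^sub>M L2_borel) (\<lambda>x. (Y x, X x))"
    and "i \<in> {1..n} \<Longrightarrow> (\<lambda>x. (Ys i x, Xs i x)) \<in> measurable P (borel \<Otimes>\<^sub>M L2_borel)"
  using assms by (auto simp: iid_sample_def prob_space.indep_vars_def)

text \<open>Both deviations that matter, \<open>g_hat - b lambda_hat\<close> and \<open>lambda_hat - \<lambda>\<close>, are sample means of a centered
  function \<open>h\<close> of the pair \<open>(Y, X)\<close>, so their second moments are computed under the common distribution.\<close>

lemma iid_average_second_moment:
  fixes h :: "real \<times> (real \<Rightarrow> real) \<Rightarrow> real"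
  assumes iid: "iid_sample P n Ys Xs M Y X" and n: "n \<ge> 1"
    and YX: "(\<lambda>x. (Y x, X x)) \<in> measurable M (borel \<Otimes>\<^sub>M L2_borel)"
    and h: "h \<in> borel_measurable (borel \<Otimes>\<^sub>M L2_borel)"
    and int: "integrable M (\<lambda>x. (h (Y x, X x))\<^sup>2)" and zero: "(LINT x|M. h (Y x, X x)) = 0"
  shows "integrable P (\<lambda>x. (1 / real n * (\<Sum>i=1..n. h (Ys i x, Xs i x)))\<^sup>2)"
    and "(LINT x|P. (1 / real n * (\<Sum>i=1..n. h (Ys i x, Xs i x)))\<^sup>2)
      = (LINT x|M. (h (Y x, X x))\<^sup>2) / real n"
proof -
  note D = iid_sampleD[OF iid]
  interpret P: prob_space P by (rule D(1))
  have transfer: "(LINT x|P. f (Ys i x, Xs i x)) = (LINT x|M. f (Y x, X x))"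
      "integrable P (\<lambda>x. f (Ys i x, Xs i x)) = integrable M (\<lambda>x. f (Y x, X x))"
    if "i \<in> {1..n}" "f \<in> borel_measurable (borel \<Otimes>\<^sub>M L2_borel)" for i and f :: "_ \<Rightarrow> real"
    using integral_distr[OF D(4)[OF that(1)] that(2)] integral_distr[OF YX that(2)]
      integrable_distr_eq[OF D(4)[OF that(1)] that(2)] integrable_distr_eq[OF YX that(2)] D(3)[OF that(1)]
    by simp_all
  have h2: "(\<lambda>z. (h z)\<^sup>2) \<in> borel_measurable (borel \<Otimes>\<^sub>M L2_borel)"
    using h by (intro borel_measurable_power)
  have "P.indep_vars (\<lambda>_. borel) (\<lambda>i x. h (Ys i x, Xs i x)) {1..n}"
    using P.indep_vars_compose2[OF D(2), of "\<lambda>_. h" "\<lambda>_. borel"] h by simp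
  then have *: "integrable P (\<lambda>x. (\<Sum>i=1..n. h (Ys i x, Xs i x))\<^sup>2)
    \<and> (LINT x|P. (\<Sum>i=1..n. h (Ys i x, Xs i x))\<^sup>2) = (\<Sum>i=1..n. (LINT x|P. (h (Ys i x, Xs i x))\<^sup>2))"
    using transfer[OF _ h] transfer[OF _ h2] int zero
    by (intro P.second_moment_sum_indep) auto
  have eq: "(1 / real n * s)\<^sup>2 = (1 / (real n)\<^sup>2) * s\<^sup>2" for s
    by (simp add: power_mult_distrib power_divide)
  show "integrable P (\<lambda>x. (1 / real n * (\<Sum>i=1..n. h (Ys i x, Xs i x)))\<^sup>2)"
    unfolding eq using * by (intro integrable_mult_right) simp
  have "(\<Sum>i=1..n. (LINT x|P. (h (Ys i x, Xs i x))\<^sup>2)) = real n * (LINT x|M. (h (Y x, X x))\<^sup>2)"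
    using transfer(1)[OF _ h2] by simp
  with * n show "(LINT x|P. (1 / real n * (\<Sum>i=1..n. h (Ys i x, Xs i x)))\<^sup>2)
      = (LINT x|M. (h (Y x, X x))\<^sup>2) / real n"
    unfolding eq by (simp add: power2_eq_square)
qed

section \<open>The scores of the regression\<close>

text \<open>The pair is \<open>(y, g)\<close>, a value of \<open>(Y, X)\<close>. The mean of \<open>score \<beta> j\<close> over a sample is
  \<open>g_hat - b lambda_hat\<close> with \<open>b\<close> the \<open>j\<close>-th coefficient of \<open>\<beta>\<close>.\<close>

definition score :: "(real \<Rightarrow> real) \<Rightarrow> nat \<Rightarrow> real \<times> (real \<Rightarrow> real) \<Rightarrow> real" where
  "score \<beta> j z = (fst z - l2_inner \<beta> (psi j) * l2_inner (snd z) (psi j)) * l2_inner (snd z) (psi j)"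

text \<open>Dominates the sum of the squares of any number of scores.\<close>

definition score_envelope :: "(real \<Rightarrow> real) \<Rightarrow> real \<times> (real \<Rightarrow> real) \<Rightarrow> real" where
  "score_envelope \<beta> z =
     2 * ((fst z)\<^sup>2 + l2_inner \<beta> \<beta> * l2_inner (snd z) (snd z)) * l2_inner (snd z) (snd z)"

lemma measurable_inner_snd: "(\<lambda>z. l2_inner (snd z) (psi j)) \<in> borel_measurable (borel \<Otimes>\<^sub>M L2_borel)"
  using measurable_compose[OF measurable_snd measurable_l2_inner[OF psi_in_L2]] .

lemma score_measurable: "score \<beta> j \<in> borel_measurable (borel \<Otimes>\<^sub>M L2_borel)"
proof -
  note [measurable] = measurable_inner_snd[of j]
  show ?thesis unfolding score_def[abs_def] by measurable
qed

text \<open>The first factor of each score is bounded uniformly in \<open>j\<close>, since \<open>b\<^sub>j\<^sup>2 \<le> \<parallel>\<beta>\<parallel>\<^sup>2\<close> and \<open>\<xi>\<^sub>j\<^sup>2 \<le> \<parallel>g\<parallel>\<^sup>2\<close>; Bessel's inequality sums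
  the second factors. The bound does not depend on \<open>m\<close>.\<close>

lemma sum_score_squares_le:
  assumes "g \<in> L2" "\<beta> \<in> L2"
  shows "(\<Sum>j=1..m. (score \<beta> j (y, g))\<^sup>2) \<le> score_envelope \<beta> (y, g)"
proof -
  define c where "c = 2 * (y\<^sup>2 + l2_inner \<beta> \<beta> * l2_inner g g)"
  have "c \<ge> 0"
    unfolding c_def by (intro mult_nonneg_nonneg add_nonneg_nonneg l2_inner_self_nonneg) auto
  have "(\<Sum>j=1..m. (score \<beta> j (y, g))\<^sup>2) \<le> (\<Sum>j=1..m. c * (l2_inner g (psi j))\<^sup>2)"
  proof (rule sum_mono)
    fix j assume j: "j \<in> {1..m}"
    define a b where "a = l2_inner \<beta> (psi j)" and "b = l2_inner g (psi j)"
    have single: "(l2_inner f (psi j))\<^sup>2 \<le> l2_inner f f" if "f \<in> L2" for f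
    proof -
      have "(l2_inner f (psi j))\<^sup>2 \<le> (\<Sum>i=1..m. (l2_inner f (psi i))\<^sup>2)"
        using j by (intro member_le_sum) auto
      also have "\<dots> \<le> l2_inner f f" by (rule Bessel_inequality[OF that])
      finally show ?thesis .
    qed
    have "(y - a * b)\<^sup>2 \<le> 2 * (y\<^sup>2 + (a * b)\<^sup>2)"
      using zero_le_power2[of "y + a * b"] by (simp add: power2_sum power2_diff)
    also have "\<dots> \<le> c"
      unfolding c_def power_mult_distrib a_def b_def using assms
      by (intro mult_left_mono add_left_mono mult_mono single l2_inner_self_nonneg) auto
    finally have "(y - a * b)\<^sup>2 * b\<^sup>2 \<le> c * b\<^sup>2"
      by (intro mult_right_mono) auto
    then show "(score \<beta> j (y, g))\<^sup>2 \<le> c * (l2_inner g (psi j))\<^sup>2"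
      by (simp add: score_def a_def b_def power_mult_distrib)
  qed
  also have "\<dots> \<le> c * l2_inner g g"
    using \<open>c \<ge> 0\<close> Bessel_inequality[OF assms(1), of m]
    by (simp add: sum_distrib_left[symmetric] mult_left_mono)
  finally show ?thesis
    by (simp add: score_envelope_def c_def)
qed

locale trig_regression = trig_diagonal_function M X \<eta>
  for M :: "'a measure" and X :: "'a \<Rightarrow> real \<Rightarrow> real" and \<eta> :: real +
  fixes Y \<epsilon> :: "'a \<Rightarrow> real" and \<beta> :: "real \<Rightarrow> real" and \<sigma> :: real
  assumes slope_L2: "\<beta> \<in> L2"
    and error_class: "\<epsilon> \<in> error_moment_class M 4 \<eta>"
    and model: "functional_linear_model M \<beta> \<sigma> Y X \<epsilon>"
begin

lemma error_measurable [measurable]: "\<epsilon> \<in> borel_measurable M"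
  and error_square_integrable: "integrable M (\<lambda>x. (\<epsilon> x)\<^sup>2)"
  and error_fourth_moment: "(\<integral>\<^sup>+x. ennreal (\<bar>\<epsilon> x\<bar> ^ 4) \<partial>M) \<le> ennreal \<eta>"
  using error_class by (auto simp: error_moment_class_def)

lemma error_fourth_integrable: "integrable M (\<lambda>x. (\<epsilon> x) ^ 4)"
proof (rule integrableI_nonneg)
  show "(\<integral>\<^sup>+x. ennreal ((\<epsilon> x) ^ 4) \<partial>M) < \<infinity>"
    using error_fourth_moment by (simp add: power_even_abs) (rule le_less_trans, auto)
qed auto

lemma Y_measurable [measurable]: "Y \<in> borel_measurable M"
  and error_uncorrelated: "f \<in> L2 \<Longrightarrow> (\<integral>x. \<epsilon> x * l2_inner (X x) f \<partial>M) = 0"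
  and Y_eq: "AE x in M. Y x = l2_inner (X x) \<beta> + \<sigma> * \<epsilon> x"
  using model by (auto simp: functional_linear_model_def l2_inner_def mult.commute)

lemma YX_measurable: "(\<lambda>x. (Y x, X x)) \<in> measurable M (borel \<Otimes>\<^sub>M L2_borel)"
  by measurable

lemma inner_X_square_le:
  assumes "x \<in> space M" "f \<in> L2"
  shows "(l2_inner (X x) f)\<^sup>2 \<le> l2_inner f f * sqnorm x"
proof -
  have "\<bar>l2_inner (X x) f\<bar>\<^sup>2 \<le> (l2_norm (X x) * l2_norm f)\<^sup>2"
    using assms by (intro power_mono l2_Cauchy_Schwarz X_in_L2) auto
  then show ?thesis
    by (simp add: power_mult_distrib l2_norm_square mult.commute)
qed

lemma inner_X_slope_measurable [measurable]: "(\<lambda>x. l2_inner (X x) \<beta>) \<in> borel_measurable M"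
  by (rule inner_X_measurable[OF slope_L2])

lemma inner_X_slope_square_integrable: "integrable M (\<lambda>x. (l2_inner (X x) \<beta>)\<^sup>2)"
proof (rule Bochner_Integration.integrable_bound)
  show "integrable M (\<lambda>x. l2_inner \<beta> \<beta> * sqnorm x)"
    by (intro integrable_mult_right sqnorm_integrable)
  show "AE x in M. norm ((l2_inner (X x) \<beta>)\<^sup>2) \<le> norm (l2_inner \<beta> \<beta> * sqnorm x)"
    using inner_X_square_le[OF _ slope_L2] by (intro AE_I2) (simp add: l2_inner_self_nonneg)
qed measurable

text \<open>\<open>E(Y \<xi>\<^sub>j) = \<lambda>\<^sub>j b\<^sub>j\<close>, because the error term is uncorrelated with \<open>X\<close>.\<close>

lemma expectation_score:
  assumes "j \<ge> 1"
  shows "(\<integral>x. score \<beta> j (Y x, X x) \<partial>M) = 0"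
proof -
  define b where "b = l2_inner \<beta> (psi j)"
  have "AE x in M. score \<beta> j (Y x, X x)
      = (\<xi> j x * l2_inner (X x) \<beta> + \<sigma> * (\<epsilon> x * \<xi> j x)) - b * (\<xi> j x)\<^sup>2"
    using Y_eq by eventually_elim (simp add: score_def b_def algebra_simps power2_eq_square)
  then have "(\<integral>x. score \<beta> j (Y x, X x) \<partial>M)
      = (\<integral>x. (\<xi> j x * l2_inner (X x) \<beta> + \<sigma> * (\<epsilon> x * \<xi> j x)) - b * (\<xi> j x)\<^sup>2 \<partial>M)"
    by (intro integral_cong_AE measurable_compose[OF YX_measurable score_measurable]) measurable
  also have "\<dots> = (\<integral>x. \<xi> j x * l2_inner (X x) \<beta> \<partial>M) + \<sigma> * (\<integral>x. \<epsilon> x * \<xi> j x \<partial>M) - b * \<Lambda> j"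
    unfolding eigval_def
    using integrable_mult_of_squares[OF \<xi>_measurable _ \<xi>_square_integrable, of "\<lambda>x. l2_inner (X x) \<beta>" j]
      integrable_mult_of_squares[OF _ \<xi>_measurable _ \<xi>_square_integrable, of \<epsilon> j]
      inner_X_slope_square_integrable error_square_integrable \<xi>_square_integrable[of j]
    by simp
  also have "\<dots> = 0"
    using expectation_\<xi>_inner[OF assms slope_L2] error_uncorrelated[OF psi_in_L2] by (simp add: b_def)
  finally show ?thesis .
qed

text \<open>\<open>Y\<^sup>2 \<le> 2 \<parallel>\<beta>\<parallel>\<^sup>2 \<parallel>X\<parallel>\<^sup>2 + 2 \<sigma>\<^sup>2 \<epsilon>\<^sup>2\<close>, and the mixed term satisfies \<open>2 \<epsilon>\<^sup>2 \<parallel>X\<parallel>\<^sup>2 \<le> \<epsilon>\<^sup>4 + \<parallel>X\<parallel>\<^sup>4\<close>, so fourth moments of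
  \<open>\<epsilon>\<close> and \<open>\<parallel>X\<parallel>\<close> suffice.\<close>

lemma score_envelope_integrable: "integrable M (\<lambda>x. score_envelope \<beta> (Y x, X x))"
proof (rule Bochner_Integration.integrable_bound)
  define B where "B = l2_inner \<beta> \<beta>"
  have "B \<ge> 0" by (simp add: B_def l2_inner_self_nonneg)
  show "integrable M (\<lambda>x. (6 * B + 2 * \<sigma>\<^sup>2) * (sqnorm x)\<^sup>2 + (2 * \<sigma>\<^sup>2) * (\<epsilon> x) ^ 4)"
    by (intro Bochner_Integration.integrable_add integrable_mult_right sqnorm_square_integrable error_fourth_integrable)
  show "(\<lambda>x. score_envelope \<beta> (Y x, X x)) \<in> borel_measurable M"
    unfolding score_envelope_def by simp
  have "AE x in M. score_envelope \<beta> (Y x, X x) \<le> (6 * B + 2 * \<sigma>\<^sup>2) * (sqnorm x)\<^sup>2 + (2 * \<sigma>\<^sup>2) * (\<epsilon> x) ^ 4"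
    using Y_eq AE_space
  proof eventually_elim
    case (elim x)
    define a where "a = l2_inner (X x) \<beta>"
    have "sqnorm x \<ge> 0" by (rule l2_inner_self_nonneg)
    have "(Y x)\<^sup>2 \<le> 2 * a\<^sup>2 + 2 * (\<sigma> * \<epsilon> x)\<^sup>2"
      using elim(1) zero_le_power2[of "a - \<sigma> * \<epsilon> x"] by (simp add: a_def power2_sum power2_diff)
    also have "\<dots> \<le> 2 * (B * sqnorm x) + 2 * \<sigma>\<^sup>2 * (\<epsilon> x)\<^sup>2"
      using inner_X_square_le[OF elim(2) slope_L2] by (simp add: a_def B_def power_mult_distrib)
    finally have "(Y x)\<^sup>2 + B * sqnorm x \<le> 3 * (B * sqnorm x) + 2 * \<sigma>\<^sup>2 * (\<epsilon> x)\<^sup>2" by simp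
    then have "2 * ((Y x)\<^sup>2 + B * sqnorm x) * sqnorm x \<le> 2 * (3 * (B * sqnorm x) + 2 * \<sigma>\<^sup>2 * (\<epsilon> x)\<^sup>2) * sqnorm x"
      using \<open>sqnorm x \<ge> 0\<close> by (intro mult_right_mono mult_left_mono) auto
    also have "\<dots> = 6 * B * (sqnorm x)\<^sup>2 + 2 * \<sigma>\<^sup>2 * (2 * ((\<epsilon> x)\<^sup>2 * sqnorm x))"
      by (simp add: algebra_simps power2_eq_square)
    also have "\<dots> \<le> 6 * B * (sqnorm x)\<^sup>2 + 2 * \<sigma>\<^sup>2 * ((\<epsilon> x) ^ 4 + (sqnorm x)\<^sup>2)"
      using zero_le_power2[of "(\<epsilon> x)\<^sup>2 - sqnorm x"]
      by (intro add_left_mono mult_left_mono) (simp_all add: power2_diff power_mult[symmetric])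
    also have "\<dots> = (6 * B + 2 * \<sigma>\<^sup>2) * (sqnorm x)\<^sup>2 + (2 * \<sigma>\<^sup>2) * (\<epsilon> x) ^ 4"
      by (simp add: distrib_left distrib_right)
    finally show ?case
      by (simp add: score_envelope_def B_def)
  qed
  moreover have "score_envelope \<beta> z \<ge> 0" for z
    unfolding score_envelope_def
    by (intro mult_nonneg_nonneg add_nonneg_nonneg l2_inner_self_nonneg) auto
  ultimately show "AE x in M. norm (score_envelope \<beta> (Y x, X x))
      \<le> norm ((6 * B + 2 * \<sigma>\<^sup>2) * (sqnorm x)\<^sup>2 + (2 * \<sigma>\<^sup>2) * (\<epsilon> x) ^ 4)"
    using \<open>B \<ge> 0\<close> by (auto elim!: AE_mp intro!: AE_I2)
qed

lemma score_square_integrable: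
  assumes "j \<ge> 1"
  shows "integrable M (\<lambda>x. (score \<beta> j (Y x, X x))\<^sup>2)"
proof (rule Bochner_Integration.integrable_bound[OF score_envelope_integrable])
  show "(\<lambda>x. (score \<beta> j (Y x, X x))\<^sup>2) \<in> borel_measurable M"
    by (intro borel_measurable_power measurable_compose[OF YX_measurable score_measurable])
  show "AE x in M. norm ((score \<beta> j (Y x, X x))\<^sup>2) \<le> norm (score_envelope \<beta> (Y x, X x))"
  proof (rule AE_I2)
    fix x assume "x \<in> space M"
    have "(score \<beta> j (Y x, X x))\<^sup>2 \<le> (\<Sum>i=1..j. (score \<beta> i (Y x, X x))\<^sup>2)"
      using assms by (intro member_le_sum) auto
    also have "\<dots> \<le> score_envelope \<beta> (Y x, X x)"
      by (rule sum_score_squares_le[OF X_in_L2[OF \<open>x \<in> space M\<close>] slope_L2])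
    finally show "norm ((score \<beta> j (Y x, X x))\<^sup>2) \<le> norm (score_envelope \<beta> (Y x, X x))"
      by simp
  qed
qed

lemma sum_score_variances_le:
  "(\<Sum>j=1..m. (\<integral>x. (score \<beta> j (Y x, X x))\<^sup>2 \<partial>M)) \<le> (\<integral>x. score_envelope \<beta> (Y x, X x) \<partial>M)"
proof -
  have "(\<Sum>j=1..m. (\<integral>x. (score \<beta> j (Y x, X x))\<^sup>2 \<partial>M)) = (\<integral>x. (\<Sum>j=1..m. (score \<beta> j (Y x, X x))\<^sup>2) \<partial>M)"
    by (intro Bochner_Integration.integral_sum[symmetric] score_square_integrable) auto
  also have "\<dots> \<le> (\<integral>x. score_envelope \<beta> (Y x, X x) \<partial>M)"
    by (intro integral_mono Bochner_Integration.integrable_sum score_square_integrable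
        score_envelope_integrable sum_score_squares_le X_in_L2 slope_L2) auto
  finally show ?thesis .
qed

end

section \<open>Bounding the risk\<close>

lemma sum_shift_Suc: "(\<Sum>k. if Suc k \<le> m then f (Suc k) else 0) = (\<Sum>j=1..m. f j)"
  for f :: "nat \<Rightarrow> ennreal"
proof -
  have "(\<Sum>k. if Suc k \<le> m then f (Suc k) else 0) = (\<Sum>k<m. if Suc k \<le> m then f (Suc k) else 0)"
    by (rule suminf_finite) auto
  also have "\<dots> = (\<Sum>j=1..m. f j)"
    by (rule sum.reindex_bij_witness[of _ "\<lambda>j. j - 1" Suc]) auto
  finally show ?thesis .
qed

text \<open>If the threshold is passed, \<open>g / l - b = (g - b l) / l\<close> with \<open>l \<ge> a\<close>; otherwise the estimated coefficient is
  zero and the error is \<open>b\<close> itself.\<close>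

lemma coefficient_error_le:
  fixes g l b a :: real
  assumes "a > 0"
  shows "(g / l * of_bool (l \<ge> a) - b)\<^sup>2 \<le> (g - b * l)\<^sup>2 / a\<^sup>2 + b\<^sup>2 * of_bool (l < a)"
proof (cases "l \<ge> a")
  case True
  with assms have "l > 0" by simp
  then have "(g / l - b)\<^sup>2 = (g - b * l)\<^sup>2 / l\<^sup>2"
    by (simp add: power_divide[symmetric] diff_divide_distrib)
  also have "\<dots> \<le> (g - b * l)\<^sup>2 / a\<^sup>2"
    using True assms by (intro divide_left_mono power_mono mult_pos_pos) auto
  finally show ?thesis using True by simp
qed (use assms in auto)

text \<open>The ratio \<open>\<gamma> / \<omega>\<close> starts at \<open>1\<close> and does not decrease, so \<open>\<omega> \<le> \<gamma>\<close>.\<close>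

lemma F_space_weighted_summable:
  assumes "\<beta> \<in> F_space \<gamma>"
    and pos: "\<And>j. j \<ge> 1 \<Longrightarrow> \<gamma> j > 0" "\<And>j. j \<ge> 1 \<Longrightarrow> \<omega> j > 0"
    and one: "\<gamma> 1 = 1" "\<omega> 1 = 1" and mono: "mono_on {1..} (\<lambda>j. \<gamma> j / \<omega> j)"
  shows "summable (\<lambda>k. \<omega> (Suc k) * (l2_inner \<beta> (psi (Suc k)))\<^sup>2)"
proof (rule summable_comparison_test')
  have "(\<Sum>k. ennreal (\<gamma> (Suc k) * (l2_inner \<beta> (psi (Suc k)))\<^sup>2)) \<noteq> \<top>"
    using assms(1) by (auto simp: F_space_def wnorm2_def)
  then show "summable (\<lambda>k. \<gamma> (Suc k) * (l2_inner \<beta> (psi (Suc k)))\<^sup>2)"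
    using pos(1) by (intro summable_suminf_not_top) (auto simp: less_imp_le)
  fix k :: nat
  have "\<gamma> 1 / \<omega> 1 \<le> \<gamma> (Suc k) / \<omega> (Suc k)"
    using mono by (rule mono_onD) auto
  then have "\<omega> (Suc k) \<le> \<gamma> (Suc k)"
    using pos(2)[of "Suc k"] one by (simp add: pos_le_divide_eq)
  then show "norm (\<omega> (Suc k) * (l2_inner \<beta> (psi (Suc k)))\<^sup>2) \<le> \<gamma> (Suc k) * (l2_inner \<beta> (psi (Suc k)))\<^sup>2"
    using pos(2)[of "Suc k"] by (simp add: abs_mult mult_right_mono)
qed

definition truncation_prob :: "nat \<Rightarrow> 'b measure \<Rightarrow> (nat \<Rightarrow> 'b \<Rightarrow> real \<Rightarrow> real) \<Rightarrow> real \<Rightarrow> nat \<Rightarrow> real" where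
  "truncation_prob n P Xs a j = measure P {x \<in> space P. lambda_hat n Xs j x < a}"

lemma estimators_measurable:
  assumes "iid_sample P n Ys Xs M Y X"
  shows "g_hat n Ys Xs j \<in> borel_measurable P" "lambda_hat n Xs j \<in> borel_measurable P"
proof -
  have 1: "(\<lambda>x. l2_inner (Xs i x) (psi j)) \<in> borel_measurable P" if "i \<in> {1..n}" for i
    using measurable_compose[OF iid_sampleD(4)[OF assms that] measurable_inner_snd] by simp
  have 2: "Ys i \<in> borel_measurable P" if "i \<in> {1..n}" for i
    using measurable_compose[OF iid_sampleD(4)[OF assms that] measurable_fst] by simp
  show "g_hat n Ys Xs j \<in> borel_measurable P"
    unfolding g_hat_def[abs_def] using 1 2
    by (intro borel_measurable_times borel_measurable_const borel_measurable_sum) auto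
  show "lambda_hat n Xs j \<in> borel_measurable P"
    unfolding lambda_hat_def[abs_def] using 1
    by (intro borel_measurable_times borel_measurable_const borel_measurable_sum borel_measurable_power) auto
qed

lemma wnorm2_beta_hat_error:
  assumes "\<beta> \<in> L2"
  shows "wnorm2 \<omega> (\<lambda>s. beta_hat n m a Ys Xs x s - \<beta> s) =
    (\<Sum>k. ennreal (\<omega> (Suc k) * ((if Suc k \<le> m then g_hat n Ys Xs (Suc k) x / lambda_hat n Xs (Suc k) x
       * of_bool (lambda_hat n Xs (Suc k) x \<ge> a) else 0) - l2_inner \<beta> (psi (Suc k)))\<^sup>2))"
proof -
  define c where "c j = g_hat n Ys Xs j x / lambda_hat n Xs j x * of_bool (lambda_hat n Xs j x \<ge> a)" for j
  have bh: "beta_hat n m a Ys Xs x = (\<lambda>s. \<Sum>j=1..m. c j * psi j s)"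
    by (simp add: beta_hat_def[abs_def] c_def)
  have "(\<lambda>s. \<Sum>j=1..m. c j * psi j s) \<in> L2"
    by (intro L2_sum L2_scale psi_in_L2)
  then have "l2_inner (\<lambda>s. beta_hat n m a Ys Xs x s - \<beta> s) (psi (Suc k))
      = (if Suc k \<le> m then c (Suc k) else 0) - l2_inner \<beta> (psi (Suc k))" for k
    unfolding bh using assms psi_in_L2 by (simp add: l2_inner_diff l2_inner_psi_combination[of "Suc k", simplified])
  then show ?thesis
    by (simp only: wnorm2_def c_def power2_abs)
qed

context trig_regression
begin

text \<open>Chebyshev's inequality: if \<open>a \<le> \<lambda>\<^sub>j / 2\<close>, an estimate of \<open>\<lambda>\<^sub>j\<close> below \<open>a\<close> misses \<open>\<lambda>\<^sub>j\<close> by at least \<open>\<lambda>\<^sub>j / 2\<close>.\<close>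

lemma truncation_prob_le:
  assumes iid: "iid_sample P n Ys Xs M Y X" and "n \<ge> 1" "j \<ge> 1" and a: "a \<le> \<Lambda> j / 2"
  shows "truncation_prob n P Xs a j \<le> 4 * (\<integral>x. ((\<xi> j x)\<^sup>2 - \<Lambda> j)\<^sup>2 \<partial>M) / (\<Lambda> j)\<^sup>2 / real n"
proof -
  interpret P: prob_space P by (rule iid_sampleD(1)[OF iid])
  define h where "h z = (l2_inner (snd z) (psi j))\<^sup>2 - \<Lambda> j" for z :: "real \<times> (real \<Rightarrow> real)"
  have pos: "\<Lambda> j > 0" using eigval_pos[OF \<open>j \<ge> 1\<close>] .
  have h: "h \<in> borel_measurable (borel \<Otimes>\<^sub>M L2_borel)"
    unfolding h_def[abs_def]
    by (intro borel_measurable_diff borel_measurable_power measurable_inner_snd borel_measurable_const)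
  have eq: "(h (Y x, X x))\<^sup>2 = (\<xi> j x) ^ 4 - 2 * \<Lambda> j * (\<xi> j x)\<^sup>2 + (\<Lambda> j)\<^sup>2" for x
    by (simp add: h_def power2_diff power_mult[symmetric] algebra_simps)
  have int: "integrable M (\<lambda>x. (h (Y x, X x))\<^sup>2)"
    unfolding eq using \<xi>_fourth_integrable(1)[OF \<open>j \<ge> 1\<close>] \<xi>_square_integrable by simp
  have zero: "(\<integral>x. h (Y x, X x) \<partial>M) = 0"
    using \<xi>_square_integrable[of j] by (simp add: h_def eigval_def prob_space)
  have mean: "1 / real n * (\<Sum>i=1..n. h (Ys i x, Xs i x)) = lambda_hat n Xs j x - \<Lambda> j" for x
    using \<open>n \<ge> 1\<close> by (simp add: h_def lambda_hat_def sum_subtractf right_diff_distrib)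
  note avg = iid_average_second_moment[OF iid \<open>n \<ge> 1\<close> YX_measurable h int zero, unfolded mean]
  have "truncation_prob n P Xs a j \<le> measure P {x \<in> space P. (lambda_hat n Xs j x - \<Lambda> j)\<^sup>2 \<ge> (\<Lambda> j / 2)\<^sup>2}"
    unfolding truncation_prob_def
  proof (rule P.finite_measure_mono)
    show "{x \<in> space P. lambda_hat n Xs j x < a} \<subseteq> {x \<in> space P. (lambda_hat n Xs j x - \<Lambda> j)\<^sup>2 \<ge> (\<Lambda> j / 2)\<^sup>2}"
    proof safe
      fix x assume "lambda_hat n Xs j x < a"
      with a have "\<Lambda> j / 2 \<le> \<Lambda> j - lambda_hat n Xs j x" by simp
      with pos have "(\<Lambda> j / 2)\<^sup>2 \<le> (\<Lambda> j - lambda_hat n Xs j x)\<^sup>2"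
        by (intro power_mono) auto
      then show "(lambda_hat n Xs j x - \<Lambda> j)\<^sup>2 \<ge> (\<Lambda> j / 2)\<^sup>2"
        by (simp add: power2_commute)
    qed
    show "{x \<in> space P. (lambda_hat n Xs j x - \<Lambda> j)\<^sup>2 \<ge> (\<Lambda> j / 2)\<^sup>2} \<in> sets P"
      using estimators_measurable(2)[OF iid, of j] by measurable
  qed
  also have "\<dots> \<le> (\<integral>x. (lambda_hat n Xs j x - \<Lambda> j)\<^sup>2 \<partial>P) / (\<Lambda> j / 2)\<^sup>2"
    using avg(1) pos by (intro integral_Markov_inequality_measure[where A = "{}"]) auto
  also have "\<dots> = 4 * (\<integral>x. ((\<xi> j x)\<^sup>2 - \<Lambda> j)\<^sup>2 \<partial>M) / (\<Lambda> j)\<^sup>2 / real n"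
    unfolding avg(2) by (simp add: h_def power_divide mult_ac)
  finally show ?thesis .
qed

text \<open>Summed over the coefficients, the bound of \<open>coefficient_error_le\<close> splits the risk into a variance term, in which
  the scores are averaged over the sample, and a bias term. The bias term combines the coefficients lost to
  the threshold with those beyond the dimension \<open>m\<close>, whose estimates are zero with certainty; this makes it one
  series with a common dominating series, ready for a dominated convergence argument.\<close>

lemma risk_le:
  assumes iid: "iid_sample P n Ys Xs M Y X" and n: "n \<ge> 1" and a: "a > 0"
    and \<omega>: "\<And>j. j \<ge> 1 \<Longrightarrow> \<omega> j > 0" and W: "\<And>j. j \<in> {1..m} \<Longrightarrow> \<omega> j \<le> W" "W \<ge> 0"
  shows "(\<integral>\<^sup>+x. wnorm2 \<omega> (\<lambda>s. beta_hat n m a Ys Xs x s - \<beta> s) \<partial>P)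
    \<le> ennreal (W * inverse (real n * a\<^sup>2) * (\<integral>x. score_envelope \<beta> (Y x, X x) \<partial>M))
      + (\<Sum>k. ennreal (\<omega> (Suc k) * (l2_inner \<beta> (psi (Suc k)))\<^sup>2
           * (if Suc k \<le> m then truncation_prob n P Xs a (Suc k) else 1)))"
proof -
  interpret P: prob_space P by (rule iid_sampleD(1)[OF iid])
  define b where "b j = l2_inner \<beta> (psi j)" for j
  define D where "D j x = g_hat n Ys Xs j x - b j * lambda_hat n Xs j x" for j x
  define A where "A j = {x \<in> space P. lambda_hat n Xs j x < a}" for j
  note [measurable] = estimators_measurable[OF iid]
  have A_meas [measurable]: "A j \<in> sets P" for j
    unfolding A_def by measurable
  have D_meas [measurable]: "D j \<in> borel_measurable P" for j
    unfolding D_def by measurable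
  \<comment> \<open>u is the variance part and v the bias part of the k-th coefficient; the shift from k to Suc k
      reflects that the basis starts at index 1.\<close>
  define u where "u k x = (if Suc k \<le> m then ennreal (\<omega> (Suc k) * ((D (Suc k) x)\<^sup>2 / a\<^sup>2)) else 0)" for k x
  define v where "v k x = ennreal (\<omega> (Suc k) * (b (Suc k))\<^sup>2) * (if Suc k \<le> m then indicator (A (Suc k)) x else 1)" for k x
  have u_meas [measurable]: "u k \<in> borel_measurable P" for k
    unfolding u_def by measurable
  have v_meas [measurable]: "v k \<in> borel_measurable P" for k
    unfolding v_def by measurable
  have "wnorm2 \<omega> (\<lambda>s. beta_hat n m a Ys Xs x s - \<beta> s) \<le> (\<Sum>k. u k x + v k x)" if x: "x \<in> space P" for x
    unfolding wnorm2_beta_hat_error[OF slope_L2]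
  proof (intro suminf_le allI)
    fix k
    show "ennreal (\<omega> (Suc k) * ((if Suc k \<le> m then g_hat n Ys Xs (Suc k) x / lambda_hat n Xs (Suc k) x
       * of_bool (lambda_hat n Xs (Suc k) x \<ge> a) else 0) - l2_inner \<beta> (psi (Suc k)))\<^sup>2) \<le> u k x + v k x"
    proof (cases "Suc k \<le> m")
      case True
      have "v k x = ennreal (\<omega> (Suc k) * ((b (Suc k))\<^sup>2 * of_bool (lambda_hat n Xs (Suc k) x < a)))"
        using True x by (auto simp: v_def A_def)
      then have "u k x + v k x = ennreal (\<omega> (Suc k) * ((D (Suc k) x)\<^sup>2 / a\<^sup>2
          + (b (Suc k))\<^sup>2 * of_bool (lambda_hat n Xs (Suc k) x < a)))"
        using True \<omega>[of "Suc k"] by (simp add: u_def distrib_left ennreal_plus[symmetric] del: ennreal_plus)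
      moreover have "\<omega> (Suc k) * (g_hat n Ys Xs (Suc k) x / lambda_hat n Xs (Suc k) x
          * of_bool (lambda_hat n Xs (Suc k) x \<ge> a) - b (Suc k))\<^sup>2
        \<le> \<omega> (Suc k) * ((D (Suc k) x)\<^sup>2 / a\<^sup>2 + (b (Suc k))\<^sup>2 * of_bool (lambda_hat n Xs (Suc k) x < a))"
        unfolding D_def using \<omega>[of "Suc k"] by (intro mult_left_mono coefficient_error_le[OF a]) auto
      ultimately show ?thesis
        using True by (simp add: b_def ennreal_leI)
    next
      case False
      then show ?thesis by (simp add: u_def v_def b_def)
    qed
  qed auto
  then have "(\<integral>\<^sup>+x. wnorm2 \<omega> (\<lambda>s. beta_hat n m a Ys Xs x s - \<beta> s) \<partial>P) \<le> (\<integral>\<^sup>+x. (\<Sum>k. u k x + v k x) \<partial>P)"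
    by (intro nn_integral_mono)
  also have "\<dots> = (\<Sum>k. \<integral>\<^sup>+x. u k x + v k x \<partial>P)"
    by (intro nn_integral_suminf) measurable
  also have "\<dots> = (\<Sum>k. (\<integral>\<^sup>+x. u k x \<partial>P) + (\<integral>\<^sup>+x. v k x \<partial>P))"
    by (intro suminf_cong nn_integral_add) measurable
  also have "\<dots> = (\<Sum>k. \<integral>\<^sup>+x. u k x \<partial>P) + (\<Sum>k. \<integral>\<^sup>+x. v k x \<partial>P)"
    by (intro suminf_add[symmetric]) auto
  also have "(\<Sum>k. \<integral>\<^sup>+x. v k x \<partial>P) = (\<Sum>k. ennreal (\<omega> (Suc k) * (l2_inner \<beta> (psi (Suc k)))\<^sup>2
           * (if Suc k \<le> m then truncation_prob n P Xs a (Suc k) else 1)))"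
  proof (intro suminf_cong)
    fix k
    have "(\<integral>\<^sup>+x. v k x \<partial>P) = ennreal (\<omega> (Suc k) * (b (Suc k))\<^sup>2) * (if Suc k \<le> m then emeasure P (A (Suc k)) else 1)"
      unfolding v_def by (subst nn_integral_cmult) (auto simp: P.emeasure_space_1)
    then show "(\<integral>\<^sup>+x. v k x \<partial>P) = ennreal (\<omega> (Suc k) * (l2_inner \<beta> (psi (Suc k)))\<^sup>2
           * (if Suc k \<le> m then truncation_prob n P Xs a (Suc k) else 1))"
      using \<omega>[of "Suc k"]
      by (simp add: b_def truncation_prob_def A_def P.emeasure_eq_measure ennreal_mult')
  qed
  also have "(\<Sum>k. \<integral>\<^sup>+x. u k x \<partial>P) \<le> ennreal (W * inverse (real n * a\<^sup>2) * (\<integral>x. score_envelope \<beta> (Y x, X x) \<partial>M))"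
  proof -
    \<comment> \<open>The sample mean of the scores is the deviation that the threshold divides by at least a.\<close>
    have mean: "1 / real n * (\<Sum>i=1..n. score \<beta> j (Ys i x, Xs i x)) = D j x" for j x
      by (simp add: D_def b_def score_def g_hat_def lambda_hat_def left_diff_distrib sum_subtractf
          right_diff_distrib sum_distrib_left power2_eq_square mult_ac)
    have D2: "integrable P (\<lambda>x. (D j x)\<^sup>2)" "(\<integral>x. (D j x)\<^sup>2 \<partial>P) = (\<integral>x. (score \<beta> j (Y x, X x))\<^sup>2 \<partial>M) / real n"
      if "j \<ge> 1" for j
      using iid_average_second_moment[OF iid n YX_measurable score_measurable
          score_square_integrable[OF that] expectation_score[OF that]] unfolding mean by auto
    have "(\<integral>\<^sup>+x. u k x \<partial>P) = (if Suc k \<le> m then ennreal (\<omega> (Suc k) / a\<^sup>2 * (\<integral>x. (D (Suc k) x)\<^sup>2 \<partial>P)) else 0)" for k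
    proof (cases "Suc k \<le> m")
      case True
      then have "(\<integral>\<^sup>+x. u k x \<partial>P) = (\<integral>\<^sup>+x. ennreal (\<omega> (Suc k) / a\<^sup>2 * (D (Suc k) x)\<^sup>2) \<partial>P)"
        by (simp add: u_def)
      also have "\<dots> = ennreal (\<integral>x. \<omega> (Suc k) / a\<^sup>2 * (D (Suc k) x)\<^sup>2 \<partial>P)"
        using D2(1)[of "Suc k"] \<omega>[of "Suc k"]
        by (intro nn_integral_eq_integral integrable_mult_right AE_I2) auto
      finally show ?thesis using True by simp
    qed (simp add: u_def)
    then have "(\<Sum>k. \<integral>\<^sup>+x. u k x \<partial>P) = (\<Sum>j=1..m. ennreal (\<omega> j / a\<^sup>2 * (\<integral>x. (D j x)\<^sup>2 \<partial>P)))"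
      using sum_shift_Suc[of m "\<lambda>j. ennreal (\<omega> j / a\<^sup>2 * (\<integral>x. (D j x)\<^sup>2 \<partial>P))"] by simp
    also have "\<dots> = ennreal (\<Sum>j=1..m. \<omega> j / a\<^sup>2 * (\<integral>x. (D j x)\<^sup>2 \<partial>P))"
      using \<omega> by (intro sum_ennreal mult_nonneg_nonneg integral_nonneg_AE) (auto simp: less_imp_le)
    also have "(\<Sum>j=1..m. \<omega> j / a\<^sup>2 * (\<integral>x. (D j x)\<^sup>2 \<partial>P))
        \<le> (\<Sum>j=1..m. W * inverse (real n * a\<^sup>2) * (\<integral>x. (score \<beta> j (Y x, X x))\<^sup>2 \<partial>M))"
    proof (rule sum_mono)
      fix j assume j: "j \<in> {1..m}"
      have "\<omega> j / a\<^sup>2 * (\<integral>x. (D j x)\<^sup>2 \<partial>P) = \<omega> j * (inverse (real n * a\<^sup>2) * (\<integral>x. (score \<beta> j (Y x, X x))\<^sup>2 \<partial>M))"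
        using D2(2)[of j] j by (simp add: field_simps)
      also have "\<dots> \<le> W * (inverse (real n * a\<^sup>2) * (\<integral>x. (score \<beta> j (Y x, X x))\<^sup>2 \<partial>M))"
        using W(1)[OF j] by (intro mult_right_mono mult_nonneg_nonneg integral_nonneg_AE) auto
      finally show "\<omega> j / a\<^sup>2 * (\<integral>x. (D j x)\<^sup>2 \<partial>P)
          \<le> W * inverse (real n * a\<^sup>2) * (\<integral>x. (score \<beta> j (Y x, X x))\<^sup>2 \<partial>M)"
        by (simp add: mult.assoc)
    qed
    also have "\<dots> \<le> W * inverse (real n * a\<^sup>2) * (\<integral>x. score_envelope \<beta> (Y x, X x) \<partial>M)"
      unfolding sum_distrib_left[symmetric] using W(2)
      by (intro mult_left_mono sum_score_variances_le mult_nonneg_nonneg) auto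
    finally show ?thesis
      by (simp add: ennreal_leI)
  qed
  finally show ?thesis
    by (simp add: add_right_mono)
qed

lemma truncation_prob_tendsto_0:
  assumes iid: "\<And>n. n \<ge> 1 \<Longrightarrow> iid_sample (P n) n (Ys n) (Xs n) M Y X"
    and "a \<longlonglongrightarrow> 0" and j: "j \<ge> 1"
  shows "(\<lambda>n. truncation_prob n (P n) (Xs n) (a n) j) \<longlonglongrightarrow> 0"
proof -
  define C where "C = 4 * (\<integral>x. ((\<xi> j x)\<^sup>2 - \<Lambda> j)\<^sup>2 \<partial>M) / (\<Lambda> j)\<^sup>2"
  have "eventually (\<lambda>n. a n < \<Lambda> j / 2) sequentially"
    using assms(2) eigval_pos[OF j] by (intro order_tendstoD(2)) auto
  then have "eventually (\<lambda>n. truncation_prob n (P n) (Xs n) (a n) j \<le> C / real n) sequentially"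
    using eventually_ge_at_top[of 1]
  proof eventually_elim
    case (elim n)
    then show ?case
      unfolding C_def using truncation_prob_le[OF iid[of n] _ j] by simp
  qed
  moreover have "(\<lambda>n. C / real n) \<longlonglongrightarrow> 0"
    by (rule lim_const_over_n)
  ultimately show ?thesis
    by (rule real_tendsto_sandwich[OF _ _ tendsto_const, rotated]) (simp add: truncation_prob_def)
qed

text \<open>Tannery's theorem with dominating series \<open>c\<close>; for fixed \<open>k\<close> the dimension eventually exceeds \<open>k\<close> and the
  probability of falling below the threshold tends to zero.\<close>

lemma bias_tendsto_0:
  assumes iid: "\<And>n. n \<ge> 1 \<Longrightarrow> iid_sample (P n) n (Ys n) (Xs n) M Y X"
    and "a \<longlonglongrightarrow> 0" and m: "filterlim m at_top sequentially"
    and c: "summable c" "\<And>k. c k \<ge> 0"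
  shows "(\<lambda>n. \<Sum>k. ennreal (c k * (if Suc k \<le> m n then truncation_prob n (P n) (Xs n) (a n) (Suc k) else 1)))
    \<longlonglongrightarrow> 0"
proof -
  define q where "q k n = (if Suc k \<le> m n then truncation_prob n (P n) (Xs n) (a n) (Suc k) else 1)" for k n
  have q01: "0 \<le> q k n \<and> q k n \<le> 1" if "n \<ge> 1" for k n
    using prob_space.prob_le_1[OF iid_sampleD(1)[OF iid[OF that]]] by (simp add: q_def truncation_prob_def)
  have bound: "norm (c k * q k n) \<le> c k" if "n \<ge> 1" for k n
    using q01[OF that, of k] c(2)[of k] by (simp add: abs_mult mult_left_le)
  have lim: "(\<lambda>n. c k * q k n) \<longlonglongrightarrow> 0" for k
  proof -
    have "eventually (\<lambda>n. q k n = truncation_prob n (P n) (Xs n) (a n) (Suc k)) sequentially"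
      using filterlim_at_top[THEN iffD1, OF m, rule_format, of "Suc k"]
      by eventually_elim (simp add: q_def)
    then have "q k \<longlonglongrightarrow> 0"
      using truncation_prob_tendsto_0[OF iid assms(2), of "Suc k"] by (simp add: tendsto_cong)
    then show ?thesis by (intro tendsto_mult_right_zero)
  qed
  have "eventually (\<lambda>(k, n). norm (c k * q k n) \<le> c k) (at_top \<times>\<^sub>F sequentially)"
    using eventually_prod_sequentially bound by (auto simp: eventually_prod_sequentially)
  from tannerys_theorem[OF lim this c(1)]
  have "(\<lambda>n. \<Sum>k. c k * q k n) \<longlonglongrightarrow> 0" by simp
  then have "(\<lambda>n. ennreal (\<Sum>k. c k * q k n)) \<longlonglongrightarrow> 0"
    using tendsto_ennrealI by fastforce
  moreover have "eventually (\<lambda>n. ennreal (\<Sum>k. c k * q k n) = (\<Sum>k. ennreal (c k * q k n))) sequentially"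
    using eventually_ge_at_top[of 1]
  proof eventually_elim
    case (elim n)
    have "summable (\<lambda>k. c k * q k n)"
      using bound[OF elim] by (intro summable_comparison_test'[OF c(1)])
    then show ?case
      using q01[OF elim] c(2) by (intro suminf_ennreal2[symmetric]) auto
  qed
  ultimately show ?thesis
    by (simp add: q_def tendsto_cong)
qed

end

theorem proposition3p1:
  fixes M :: "'a measure" and X :: "'a \<Rightarrow> real \<Rightarrow> real" and Y \<epsilon> :: "'a \<Rightarrow> real"
    and P :: "nat \<Rightarrow> 'b measure"
    and Ys :: "nat \<Rightarrow> nat \<Rightarrow> 'b \<Rightarrow> real" and Xs :: "nat \<Rightarrow> nat \<Rightarrow> 'b \<Rightarrow> real \<Rightarrow> real"
    and \<beta> :: "real \<Rightarrow> real" and \<sigma> \<eta> :: real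
    and \<gamma> \<omega> :: "nat \<Rightarrow> real" and m :: "nat \<Rightarrow> nat" and \<alpha> :: "nat \<Rightarrow> real"
  assumes "prob_space M" and "\<sigma> > 0" and "\<eta> \<ge> 1"
    and "\<And>j. j \<ge> 1 \<Longrightarrow> \<gamma> j > 0" and "\<And>j. j \<ge> 1 \<Longrightarrow> \<omega> j > 0"
    and "\<gamma> 1 = 1" and "\<omega> 1 = 1"
    and "mono_on {1..} \<gamma>" and "mono_on {1..} (\<lambda>j. \<gamma> j / \<omega> j)"
    and "\<beta> \<in> F_space \<gamma>"
    and "X \<in> X_moment_class M 4 \<eta>" and "diagonal_in_trig_basis M X"
    and "\<epsilon> \<in> error_moment_class M 4 \<eta>"
    and "functional_linear_model M \<beta> \<sigma> Y X \<epsilon>"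
    and "\<And>n. n \<ge> 1 \<Longrightarrow> iid_sample (P n) n (Ys n) (Xs n) M Y X"
    and "\<And>n. n \<ge> 1 \<Longrightarrow> m n \<ge> 1" and "\<And>n. n \<ge> 1 \<Longrightarrow> \<alpha> n > 0"
    and "filterlim m at_top sequentially"
    and "\<alpha> \<longlonglongrightarrow> 0"
    and "(\<lambda>n. (SUP j\<in>{1..m n}. \<omega> j) * inverse (real n * (\<alpha> n)\<^sup>2)) \<longlonglongrightarrow> 0"
  shows "(\<lambda>n. \<integral>\<^sup>+x. wnorm2 \<omega> (\<lambda>s. beta_hat n (m n) (\<alpha> n) (Ys n) (Xs n) x s - \<beta> s) \<partial>(P n))
           \<longlonglongrightarrow> 0"
proof -
  interpret trig_regression M X \<eta> Y \<epsilon> \<beta> \<sigma>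
    using assms by (auto simp: trig_regression_def trig_diagonal_function_def trig_regression_axioms_def
        trig_diagonal_function_axioms_def F_space_def)
  define V where "V = (\<integral>x. score_envelope \<beta> (Y x, X x) \<partial>M)"
  define c where "c k = \<omega> (Suc k) * (l2_inner \<beta> (psi (Suc k)))\<^sup>2" for k
  define W where "W n = (SUP j\<in>{1..m n}. \<omega> j)" for n
  define bias where "bias n = (\<Sum>k. ennreal (c k *
      (if Suc k \<le> m n then truncation_prob n (P n) (Xs n) (\<alpha> n) (Suc k) else 1)))" for n
  have c: "summable c" "c k \<ge> 0" for k
    using F_space_weighted_summable[OF assms(10,4,5,6,7,9)] assms(5)[of "Suc k"]
    by (simp_all add: c_def[abs_def] less_imp_le)
  have "(\<lambda>n. ennreal (W n * inverse (real n * (\<alpha> n)\<^sup>2) * V)) \<longlonglongrightarrow> ennreal (0 * V)"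
    unfolding W_def by (intro tendsto_ennrealI tendsto_mult tendsto_const assms)
  moreover have "bias \<longlonglongrightarrow> 0"
    unfolding bias_def[abs_def] using assms(15)
    by (rule bias_tendsto_0[OF _ assms(19,18) c])
  ultimately have "(\<lambda>n. ennreal (W n * inverse (real n * (\<alpha> n)\<^sup>2) * V) + bias n) \<longlonglongrightarrow> 0 + 0"
    by (intro tendsto_add) auto
  then have lim: "(\<lambda>n. ennreal (W n * inverse (real n * (\<alpha> n)\<^sup>2) * V) + bias n) \<longlonglongrightarrow> 0"
    by simp
  have le: "eventually (\<lambda>n. (\<integral>\<^sup>+x. wnorm2 \<omega> (\<lambda>s. beta_hat n (m n) (\<alpha> n) (Ys n) (Xs n) x s - \<beta> s) \<partial>(P n))
      \<le> ennreal (W n * inverse (real n * (\<alpha> n)\<^sup>2) * V) + bias n) sequentially"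
    using eventually_ge_at_top[of 1]
  proof eventually_elim
    case (elim n)
    have W: "\<omega> j \<le> W n" if "j \<in> {1..m n}" for j
      unfolding W_def using that by (intro cSUP_upper) auto
    have "W n \<ge> 0"
      using W[of 1] assms(16)[OF elim] assms(7) by simp
    with W show ?case
      unfolding V_def bias_def c_def by (intro risk_le assms elim) auto
  qed
  show ?thesis
    by (rule tendsto_sandwich[OF _ le tendsto_const lim]) simp
qed

end
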